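(* In the setting of the context (problem $F=f+h$ with $f$ possibly nonconvex, algorithm Ada-BPSG, standing assumptions 1--5), suppose $F$ is bounded below by $F_{\inf}>-\infty$. Let $$\Gamma_b:=\frac{8\sigma_b M^2 n(2n-b)}{b^3}.$$ If $$\Gamma_b\,\eta_{\max}+\bar L\le\frac{1}{\eta_{\max}},$$ then for every $K\ge1$ and $R$ drawn independently (of the algorithm) and uniformly from $\{0,\dots,K-1\}$, $$\mathbb{E}\left[\|\mathcal{R}_R\|^2\right]\le\frac{2\,(F(x_0)-F_{\inf})}{K\,\eta_{\max}},$$ where, for each $k$, $$\mathcal{R}_k:=\frac{x_k-\widetilde x_{k+1}}{\eta_{\max}},\qquad \widetilde x_{k+1}:=\arg\min_{u\in\mathbf{E}}\left\{\langle\nabla f(x_k),u\rangle+\frac1{\eta_k}D_\psi(u,x_k)+h(u)\right\}.$$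
   Context: **Setting.** $\mathbf{E}$ is a finite-dimensional real normed space with norm $\|\cdot\|$, dual space $\mathbf{E}^*$, duality pairing $\langle\cdot,\cdot\rangle$ and dual norm $\|y\|_*=\max\{\langle y,x\rangle:\|x\|\le 1\}$. Let $n\ge1$, $[n]=\{1,\dots,n\}$, $f_i:\mathbf{E}\to\mathbb{R}$ for $i\in[n]$, $f=\frac1n\sum_{i=1}^n f_i$, $h:\mathbf{E}\to(-\infty,+\infty]$, and $F=f+h$, to be minimized over $\mathbf{E}$. $\mathcal{X}\subset\mathbf{E}$ is a nonempty, convex, open set on which the $f_i$ are differentiable and $f$ is lower semicontinuous and continuously differentiable. Gradients are elements of $\mathbf{E}^*$. For $\psi:\mathbf{E}\to\mathbb{R}$ differentiable, $D_\psi(x,y)=\psi(x)-\psi(y)-\langle\nabla\psi(y),x-y\rangle$. **Algorithm Ada-BPSG.** Parameters: batch size $b\in\{1,\dots,n\}$, initial point $x_0$, bounds $0<\eta_{\min}\le\eta_{\max}$, initial step size $\eta_0\in[\eta_{\min},\eta_{\max}]$, update frequency $m\ge1$ (an integer), $\alpha>0$, $\theta>0$. Initialize $\phi_i^0=x_0$ for all $i$, $\mu_0=\frac1n\sum_i\nabla f_i(\phi_i^0)$, $\xi_0=\delta_0=0$. For $k=0,1,2,\dots$: (i) If $k>0$, set $\eta_k=\eta_{k-1}$. If moreover $k \bmod m=0$, let $\widehat\eta_k=\frac1\alpha\frac{\xi_k}{\delta_k+\theta\xi_k}$ if $\xi_k>0$ and $\widehat\eta_k=\eta_{k-1}$ if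 $\xi_k=0$; set $\eta_k=\max\{\eta_{k-1},\min\{\eta_{\max},\max\{\eta_{\min},\widehat\eta_k\}\}\}$; then reset $\xi_k=\delta_k=0$. (ii) Draw a batch $B_k\subset[n]$ of size $b$ uniformly without replacement. Set $\phi_i^{k+1}=x_k$ for $i\in B_k$ and $\phi_i^{k+1}=\phi_i^k$ for $i\notin B_k$. (iii) $\widetilde\nabla_k=\frac1b\sum_{i\in B_k}(\nabla f_i(\phi_i^{k+1})-\nabla f_i(\phi_i^k))+\mu_k$. (iv) $x_{k+1}=\arg\min_x\{h(x)+\langle\widetilde\nabla_k,x\rangle+\frac1{\eta_k}D_\psi(x,x_k)\}$. (v) With $y_i=\nabla f_i(\phi_i^{k+1})-\nabla f_i(\phi_i^k)$ and $s_i=\phi_i^{k+1}-\phi_i^k$, set $\xi_{k+1}=\xi_k+\sum_{i\in B_k}|\langle y_i,s_i\rangle|$, $\delta_{k+1}=\delta_k+\sum_{i\in B_k}\|y_i\|_*^2$, $\mu_{k+1}=\mu_k+\frac1n\sum_{i\in B_k}y_i$. Let $\mathcal{F}_k=\sigma(B_0,\dots,B_{k-1})$. **Standing assumptions.** 1. $\psi$ is continuously differentiable and 1-strongly convex: $D_\psi(x,y)\ge\frac12\|x-y\|^2$ for all $x,y$. $h$ is proper, closed and convex. For every $x\in D$ ($D$ as in 2), $\mathcal{G}\in\mathbf{E}^*$, $\eta\in[\eta_{\min},\eta_{\max}]$, the problem $\min_u\{\langle\mathcal{G},u\rangle+\frac1\eta D_\psi(u,x)+h(u)\}$ has a unique solution.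 2. There is a deterministic bounded convex set $D\subset\mathcal{X}$ with $x_k,\phi_i^k\in D$ almost surely for all $k,i$. 3. Conditionally on $\mathcal{F}_k$, $B_k$ is uniform of size $b$ without replacement from $[n]$. There is a deterministic constant $\sigma_b\ge1$ such that, writing $I_1,\dots,I_b$ for the sampled indices, for all deterministic $v_1,\dots,v_n\in\mathbf{E}^*$ with $\bar v=\frac1n\sum_i v_i$, $\mathbb{E}\bigl[\|\frac1b\sum_{j=1}^b(v_{I_j}-\bar v)\|_*^2\bigr]\le\frac{\sigma_b}{bn}\sum_{i=1}^n\|v_i-\bar v\|_*^2$. 4. There are constants $\bar L>0$, $\underline{L}\ge0$ with $-\underline{L}D_\psi(x,y)\le f(x)-f(y)-\langle\nabla f(y),x-y\rangle\le\bar L D_\psi(x,y)$ for all $x,y\in D$. 5. There is a deterministic constant $M\ge0$ with $\|\nabla f_i(x)-\nabla f_i(y)\|_*\le M\|x-y\|$ for all $x,y\in D$, $i\in[n]$. *)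

theory Defs
  imports "HOL-Probability.Probability"
begin

text \<open>
  The dual space is the type of bounded linear functionals, whose norm is the dual (operator) norm.
  Meaningful only at points where the function is differentiable.
\<close>
definition grad :: "('a::real_normed_vector \<Rightarrow> real) \<Rightarrow> 'a \<Rightarrow> ('a \<Rightarrow>\<^sub>L real)" where
  "grad g x = Blinfun (frechet_derivative g (at x))"

definition bregman :: "('a::real_normed_vector \<Rightarrow> real) \<Rightarrow> 'a \<Rightarrow> 'a \<Rightarrow> real" where
  "bregman \<psi> x y = \<psi> x - \<psi> y - blinfun_apply (grad \<psi> y) (x - y)"

definition favg :: "nat \<Rightarrow> (nat \<Rightarrow> 'a \<Rightarrow> real) \<Rightarrow> 'a \<Rightarrow> real" where
  "favg n fs x = (1 / real n) * (\<Sum>i\<in>{1..n}. fs i x)"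

definition objective :: "nat \<Rightarrow> (nat \<Rightarrow> 'a \<Rightarrow> real) \<Rightarrow> ('a \<Rightarrow> ereal) \<Rightarrow> 'a \<Rightarrow> ereal" where
  "objective n fs h x = ereal (favg n fs x) + h x"

text \<open>The library's \<open>epigraph\<close> covers real-valued functions only.\<close>
definition epi :: "('a \<Rightarrow> ereal) \<Rightarrow> ('a \<times> real) set" where
  "epi h = {(x, r). h x \<le> ereal r}"

definition proper_closed_convex :: "('a::real_normed_vector \<Rightarrow> ereal) \<Rightarrow> bool" where
  "proper_closed_convex h \<longleftrightarrow>
     (\<forall>x. h x \<noteq> -\<infinity>) \<and> (\<exists>x. h x \<noteq> \<infinity>) \<and> closed (epi h) \<and> convex (epi h)"

definition lower_semicontinuous_on :: "'a::topological_space set \<Rightarrow> ('a \<Rightarrow> real) \<Rightarrow> bool" where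
  "lower_semicontinuous_on X g \<longleftrightarrow> (\<forall>c. openin (top_of_set X) {x \<in> X. c < g x})"

definition cont_differentiable_on :: "('a::real_normed_vector \<Rightarrow> real) \<Rightarrow> 'a set \<Rightarrow> bool" where
  "cont_differentiable_on g X \<longleftrightarrow>
     (\<forall>x\<in>X. g differentiable (at x)) \<and> continuous_on X (grad g)"

definition prox_obj :: "('a::real_normed_vector \<Rightarrow> ereal) \<Rightarrow> ('a \<Rightarrow> real) \<Rightarrow>
    ('a \<Rightarrow>\<^sub>L real) \<Rightarrow> real \<Rightarrow> 'a \<Rightarrow> 'a \<Rightarrow> ereal" where
  "prox_obj h \<psi> g \<eta> x u = ereal (blinfun_apply g u + (1 / \<eta>) * bregman \<psi> u x) + h u"

definition prox_step :: "('a::real_normed_vector \<Rightarrow> ereal) \<Rightarrow> ('a \<Rightarrow> real) \<Rightarrow>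
    ('a \<Rightarrow>\<^sub>L real) \<Rightarrow> real \<Rightarrow> 'a \<Rightarrow> 'a" where
  "prox_step h \<psi> g \<eta> x = arg_min (prox_obj h \<psi> g \<eta> x) (\<lambda>_. True)"

text \<open>
  One trajectory of Ada-BPSG for a given batch sequence \<open>B\<close>.  The equations determine all the
  sequences.  \<open>\<xi> k\<close> and \<open>\<delta> k\<close> are the values at the beginning of iteration \<open>k\<close>, that is, before
  the reset, which is performed inside the update of \<open>\<xi>\<close> and \<open>\<delta>\<close>.
\<close>
locale ada_bpsg_run =
  fixes n b m :: nat
    and fs :: "nat \<Rightarrow> 'a::real_normed_vector \<Rightarrow> real" and h :: "'a \<Rightarrow> ereal" and \<psi> :: "'a \<Rightarrow> real"
    and \<alpha> \<theta> \<eta>min \<eta>max \<eta>0 :: real and x0 :: 'a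
    and B :: "nat \<Rightarrow> nat set"
    and x :: "nat \<Rightarrow> 'a" and \<phi> :: "nat \<Rightarrow> nat \<Rightarrow> 'a" and \<mu> G :: "nat \<Rightarrow> ('a \<Rightarrow>\<^sub>L real)"
    and \<xi> \<delta> \<eta> :: "nat \<Rightarrow> real"
  assumes x_0: "x 0 = x0"
    and phi_0: "\<phi> 0 i = x0"
    and mu_0: "\<mu> 0 = (1 / real n) *\<^sub>R (\<Sum>i\<in>{1..n}. grad (fs i) (\<phi> 0 i))"
    and xi_0: "\<xi> 0 = 0"
    and delta_0: "\<delta> 0 = 0"
    and eta_0: "\<eta> 0 = \<eta>0"
    and eta_Suc: "\<eta> (Suc k) =
      (if Suc k mod m = 0
       then max (\<eta> k) (min \<eta>max (max \<eta>min
              (if \<xi> (Suc k) > 0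
               then (1 / \<alpha>) * (\<xi> (Suc k) / (\<delta> (Suc k) + \<theta> * \<xi> (Suc k)))
               else \<eta> k)))
       else \<eta> k)"
    and phi_Suc: "\<phi> (Suc k) i = (if i \<in> B k then x k else \<phi> k i)"
    and G_eq: "G k =
      (1 / real b) *\<^sub>R (\<Sum>i\<in>B k. grad (fs i) (\<phi> (Suc k) i) - grad (fs i) (\<phi> k i)) + \<mu> k"
    and x_Suc: "x (Suc k) = prox_step h \<psi> (G k) (\<eta> k) (x k)"
    and xi_Suc: "\<xi> (Suc k) =
      (if 0 < k \<and> k mod m = 0 then 0 else \<xi> k)
      + (\<Sum>i\<in>B k. \<bar>blinfun_apply (grad (fs i) (\<phi> (Suc k) i) - grad (fs i) (\<phi> k i))
                     (\<phi> (Suc k) i - \<phi> k i)\<bar>)"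
    and delta_Suc: "\<delta> (Suc k) =
      (if 0 < k \<and> k mod m = 0 then 0 else \<delta> k)
      + (\<Sum>i\<in>B k. (norm (grad (fs i) (\<phi> (Suc k) i) - grad (fs i) (\<phi> k i)))\<^sup>2)"
    and mu_Suc: "\<mu> (Suc k) =
      \<mu> k + (1 / real n) *\<^sub>R (\<Sum>i\<in>B k. grad (fs i) (\<phi> (Suc k) i) - grad (fs i) (\<phi> k i))"

definition batches :: "nat \<Rightarrow> nat \<Rightarrow> nat set set" where
  "batches n b = {S. S \<subseteq> {1..n} \<and> card S = b}"

text \<open>The sigma-algebra generated by the batches with index in \<open>J\<close>.\<close>
definition batch_sigma :: "'w measure \<Rightarrow> ('w \<Rightarrow> nat \<Rightarrow> nat set) \<Rightarrow> nat set \<Rightarrow> 'w measure" where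
  "batch_sigma P B J =
     sigma (space P) (\<Union>j\<in>J. {(\<lambda>\<omega>. B \<omega> j) -` A \<inter> space P | A. A \<in> sets (count_space UNIV)})"

definition batch_filtration :: "'w measure \<Rightarrow> ('w \<Rightarrow> nat \<Rightarrow> nat set) \<Rightarrow> nat \<Rightarrow> 'w measure" where
  "batch_filtration P B k = batch_sigma P B {..<k}"

definition uniform_batches ::
    "nat \<Rightarrow> nat \<Rightarrow> 'w measure \<Rightarrow> ('w \<Rightarrow> nat \<Rightarrow> nat set) \<Rightarrow> bool" where
  "uniform_batches n b P B \<longleftrightarrow>
     (\<forall>k. (\<lambda>\<omega>. B \<omega> k) \<in> measurable P (count_space (batches n b)) \<and>
        (\<forall>S\<in>batches n b. AE \<omega> in P.
           real_cond_exp P (batch_filtration P B k) (indicator {\<omega> \<in> space P. B \<omega> k = S}) \<omega>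
             = 1 / real (n choose b)))"

definition Gamma_b :: "real \<Rightarrow> real \<Rightarrow> nat \<Rightarrow> nat \<Rightarrow> real" where
  "Gamma_b \<sigma>b M n b = 8 * \<sigma>b * M\<^sup>2 * real n * (2 * real n - real b) / (real b)^3"

text \<open>The residual is normalised by \<open>\<eta>max\<close>, whereas the exact step uses the current \<open>\<eta>\<close>.\<close>
definition residual :: "nat \<Rightarrow> (nat \<Rightarrow> 'a::real_normed_vector \<Rightarrow> real) \<Rightarrow> ('a \<Rightarrow> ereal) \<Rightarrow>
    ('a \<Rightarrow> real) \<Rightarrow> real \<Rightarrow> real \<Rightarrow> 'a \<Rightarrow> 'a" where
  "residual n fs h \<psi> \<eta>max \<eta> x =
     (1 / \<eta>max) *\<^sub>R (x - prox_step h \<psi> (grad (favg n fs) x) \<eta> x)"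

end

theory Submission
  imports Defs
begin

text \<open>
  Write \<open>e\<^sub>k\<close> for the difference between the estimator \<open>G k\<close> and the gradient of \<open>f\<close> at
  \<open>x k\<close>, \<open>d\<^sub>k\<close> for the step \<open>x (Suc k) - x k\<close>, and \<open>r\<^sub>k\<close> for the residual.

  \<^bold>\<open>Descent.\<close>  The iterate \<open>x (Suc k)\<close> and the exact proximal point come from the same proximal
  problem, with linear terms that differ by \<open>e\<^sub>k\<close>.  Each satisfies the three-point inequality for
  Bregman proximal steps (\<open>prox_three_point_inequality\<close>); testing the exact point against \<open>x k\<close> and
  the iterate against the exact point, and adding, makes the values of \<open>h\<close> at the exact point cancel,
  and leaves a Bregman distance between the two points that absorbs \<open>e\<^sub>k\<close> by Young's inequality
  (\<open>inexact_prox_descent\<close>).  With relative smoothness of \<open>f\<close>, and with the slack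
  \<open>1 / \<eta>max - Lbar \<ge> \<Gamma> * \<eta>max\<close> of the step size condition, every step lowers \<open>F\<close> by at least
  \<open>\<eta>max / 2 * (\<parallel>r\<^sub>k\<parallel>\<^sup>2 + \<Gamma> * \<parallel>d\<^sub>k\<parallel>\<^sup>2 - \<parallel>e\<^sub>k\<parallel>\<^sup>2)\<close> (\<open>objective_decrease\<close>).  Summing, the
  theorem follows once the expected sum of \<open>\<parallel>e\<^sub>k\<parallel>\<^sup>2\<close> is at most \<open>\<Gamma>\<close> times the expected sum of
  \<open>\<parallel>d\<^sub>k\<parallel>\<^sup>2\<close>.

  \<^bold>\<open>Variance.\<close>  Since \<open>\<mu> k\<close> is the average of the stored gradients, \<open>e\<^sub>k\<close> is the sampling error of a
  batch average of the vectors \<open>grad (fs i) (x k) - grad (fs i) (\<phi> k i)\<close>.  The variance hypothesis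
  and the Lipschitz bound dominate its conditional second moment by
  \<open>4 * \<sigma>b * M\<^sup>2 / (b * n)\<close> times the staleness, the sum over \<open>i\<close> of \<open>\<parallel>x k - \<phi> k i\<parallel>\<^sup>2\<close>
  (\<open>estimate_error_variance\<close>).  An entry of the table survives a step with probability \<open>1 - p\<close>,
  where \<open>p = b / n\<close>, so the expected staleness contracts by the factor \<open>1 - p / 2\<close> up to a
  multiple of \<open>\<parallel>d\<^sub>k\<parallel>\<^sup>2\<close> (\<open>staleness_recursion\<close>).  Summing this geometric recursion gives exactly the
  constant \<open>\<Gamma>\<close> (\<open>total_variance_bound\<close>).

  \<^bold>\<open>Probability.\<close>  There are finitely many possible batches and the algorithm is otherwise
  deterministic, so the state at time \<open>k\<close> is a function of finitely many random variables with
  finitely many values.  Measurability and integrability are then automatic, and conditioning on the past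
  becomes an average over the values of the fresh batch (\<open>expectation_fresh_batch\<close>).
\<close>

section \<open>Inexact Bregman proximal steps\<close>

lemma has_derivative_grad:
  assumes "g differentiable (at y)"
  shows "(g has_derivative blinfun_apply (grad g y)) (at y)"
proof -
  have d: "(g has_derivative frechet_derivative g (at y)) (at y)"
    using assms by (simp add: frechet_derivative_works)
  then have "bounded_linear (frechet_derivative g (at y))"
    by (rule has_derivative_bounded_linear)
  with d show ?thesis
    by (simp add: grad_def bounded_linear_Blinfun_apply)
qed

lemma grad_favg:
  assumes "\<And>i. i \<in> {1..n} \<Longrightarrow> fs i differentiable (at y)"
  shows "grad (favg n fs) y = (1 / real n) *\<^sub>R (\<Sum>i\<in>{1..n}. grad (fs i) y)"
proof -
  have "((\<lambda>z. (1 / real n) * (\<Sum>i\<in>{1..n}. fs i z)) has_derivative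
      (\<lambda>z. (1 / real n) * (\<Sum>i\<in>{1..n}. blinfun_apply (grad (fs i) y) z))) (at y)"
    using assms by (intro has_derivative_mult_right has_derivative_sum has_derivative_grad)
  also have "(\<lambda>z. (1 / real n) * (\<Sum>i\<in>{1..n}. fs i z)) = favg n fs"
    by (simp add: favg_def fun_eq_iff)
  also have "(\<lambda>z. (1 / real n) * (\<Sum>i\<in>{1..n}. blinfun_apply (grad (fs i) y) z))
      = blinfun_apply ((1 / real n) *\<^sub>R (\<Sum>i\<in>{1..n}. grad (fs i) y))"
    by (simp add: fun_eq_iff blinfun.scaleR_left blinfun.sum_left)
  finally have "frechet_derivative (favg n fs) (at y)
      = blinfun_apply ((1 / real n) *\<^sub>R (\<Sum>i\<in>{1..n}. grad (fs i) y))"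
    by (metis frechet_derivative_at)
  then show ?thesis
    by (simp add: grad_def blinfun_apply_inverse)
qed

text \<open>
  Convexity enters through the epigraph; this is the inequality between real values that the
  variational argument below needs.
\<close>
lemma proper_closed_convex_along_segment:
  assumes h: "proper_closed_convex h" and "h y = ereal r" "h u = ereal s" "0 \<le> t" "t \<le> 1"
  shows "h (y + t *\<^sub>R (u - y)) \<le> ereal (r + t * (s - r))"
proof -
  have "convex (epi h)" using h by (simp add: proper_closed_convex_def)
  moreover have "(y, r) \<in> epi h" "(u, s) \<in> epi h" using assms by (auto simp: epi_def)
  ultimately have "(1 - t) *\<^sub>R (y, r) + t *\<^sub>R (u, s) \<in> epi h"
    using assms(4,5) by (intro convexD) auto
  moreover have "(1 - t) *\<^sub>R (y, r) + t *\<^sub>R (u, s) = (y + t *\<^sub>R (u - y), r + t * (s - r))"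
    by (simp add: algebra_simps)
  ultimately show ?thesis by (simp add: epi_def)
qed

lemma bregman_three_points:
  "bregman \<psi> u x - bregman \<psi> u y - bregman \<psi> y x
     = blinfun_apply (grad \<psi> y) (u - y) - blinfun_apply (grad \<psi> x) (u - y)"
  by (simp add: bregman_def blinfun.diff_right)

text \<open>
  First-order optimality of \<open>y\<close>: moving from \<open>y\<close> towards \<open>u\<close> cannot decrease the proximal objective.
  Along the segment \<open>h\<close> lies below its chord, so the difference quotients of \<open>\<psi>\<close> have a lower bound
  that does not depend on the step, and it passes to the directional derivative.  The three-point identity
  turns this derivative into Bregman distances.  In particular \<open>h y\<close> is finite.
\<close>
lemma prox_three_point_inequality:
  fixes h :: "'a::real_normed_vector \<Rightarrow> ereal"
  assumes h: "proper_closed_convex h"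
    and diff: "\<psi> differentiable (at y)"
    and \<eta>: "0 < \<eta>"
    and y: "is_arg_min (prox_obj h \<psi> g \<eta> x) (\<lambda>_. True) y"
    and s: "h u = ereal s"
  shows "\<exists>r. h y = ereal r \<and>
    r + blinfun_apply g (y - u) + (bregman \<psi> y x + bregman \<psi> u y) / \<eta> \<le> s + bregman \<psi> u x / \<eta>"
proof -
  have le: "prox_obj h \<psi> g \<eta> x y \<le> prox_obj h \<psi> g \<eta> x z" for z
    using y by (auto simp: is_arg_min_def not_less)
  have "h y \<noteq> \<infinity>"
    using le[of u] s by (auto simp: prox_obj_def)
  moreover have "h y \<noteq> -\<infinity>"
    using h by (simp add: proper_closed_convex_def)
  ultimately obtain r where r: "h y = ereal r" by (cases "h y") auto
  define d where "d = u - y"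
  define q where "q t = \<psi> (y + t *\<^sub>R d)" for t :: real
  \<comment> \<open>The inequality \<open>c \<le> grad \<psi> y d\<close> is the claim, solved for the derivative of \<open>\<psi>\<close> at \<open>y\<close>.\<close>
  define c where "c = blinfun_apply (grad \<psi> x) d - \<eta> * (s - r + blinfun_apply g d)"
  have slope: "c \<le> (q t - q 0) / t" if t: "0 < t" "t \<le> 1" for t
  proof -
    have "prox_obj h \<psi> g \<eta> x y \<le> prox_obj h \<psi> g \<eta> x (y + t *\<^sub>R d)" by (rule le)
    also have "\<dots> \<le> ereal (blinfun_apply g (y + t *\<^sub>R d) + (1 / \<eta>) * bregman \<psi> (y + t *\<^sub>R d) x)
        + ereal (r + t * (s - r))"
      unfolding prox_obj_def d_def
      by (intro add_left_mono proper_closed_convex_along_segment[OF h r s]) (use t in auto)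
    finally have "blinfun_apply g y + (1 / \<eta>) * bregman \<psi> y x + r
        \<le> blinfun_apply g (y + t *\<^sub>R d) + (1 / \<eta>) * bregman \<psi> (y + t *\<^sub>R d) x + (r + t * (s - r))"
      by (simp add: prox_obj_def r)
    moreover have "bregman \<psi> (y + t *\<^sub>R d) x
        = bregman \<psi> y x + (q t - q 0 - t * blinfun_apply (grad \<psi> x) d)"
      by (simp add: bregman_def q_def blinfun.add_right blinfun.diff_right blinfun.scaleR_right)
    ultimately have "0 \<le> t * (s - r + blinfun_apply g d)
        + (1 / \<eta>) * (q t - q 0 - t * blinfun_apply (grad \<psi> x) d)"
      by (simp only: distrib_left blinfun.add_right blinfun.scaleR_right) (simp add: algebra_simps)
    from mult_left_mono[OF this, of \<eta>] have "0 \<le> \<eta> * (t * (s - r + blinfun_apply g d))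
        + (q t - q 0 - t * blinfun_apply (grad \<psi> x) d)"
      using \<eta> by (simp add: distrib_left)
    then have "c * t \<le> q t - q 0" by (simp add: c_def algebra_simps)
    then show ?thesis using t by (simp add: pos_le_divide_eq)
  qed
  have "((\<lambda>t. \<psi> (y + t *\<^sub>R d)) has_derivative (\<lambda>t. blinfun_apply (grad \<psi> y) (0 + t *\<^sub>R d))) (at 0)"
    by (rule has_derivative_compose[of "\<lambda>t. y + t *\<^sub>R d" "\<lambda>t. 0 + t *\<^sub>R d" 0 UNIV \<psi>])
       (auto intro!: derivative_eq_intros has_derivative_grad diff)
  then have "(q has_field_derivative blinfun_apply (grad \<psi> y) d) (at 0)"
    by (simp add: has_field_derivative_def q_def[abs_def] blinfun.scaleR_right mult_commute_abs)
  then have "((\<lambda>t. (q t - q 0) / t) \<longlongrightarrow> blinfun_apply (grad \<psi> y) d) (at 0)"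
    by (simp add: DERIV_def)
  then have "((\<lambda>t. (q t - q 0) / t) \<longlongrightarrow> blinfun_apply (grad \<psi> y) d) (at_right 0)"
    by (rule tendsto_mono[rotated]) (simp add: at_le)
  moreover have "\<forall>\<^sub>F t in at_right (0::real). c \<le> (q t - q 0) / t"
    unfolding eventually_at_right_field using slope by (intro exI[of _ 1]) auto
  ultimately have "c \<le> blinfun_apply (grad \<psi> y) d"
    by (rule tendsto_lowerbound) simp
  then have "r + blinfun_apply g (y - u) - s
      \<le> (blinfun_apply (grad \<psi> y) d - blinfun_apply (grad \<psi> x) d) / \<eta>"
    unfolding pos_le_divide_eq[OF \<eta>] by (simp add: c_def d_def blinfun.diff_right algebra_simps)
  also have "\<dots> = (bregman \<psi> u x - bregman \<psi> u y - bregman \<psi> y x) / \<eta>"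
    by (simp add: bregman_three_points d_def)
  finally show ?thesis using r
    by (simp add: diff_divide_distrib add_divide_distrib)
qed

text \<open>
  The term \<open>bregman \<psi> xt x\<close> occurs on opposite sides of the two three-point inequalities and
  cancels.  The term \<open>bregman \<psi> x xt\<close> gives the squared distance to the exact point, and
  \<open>bregman \<psi> xt xp\<close> pays for the quadratic term that Young's inequality produces from
  \<open>g - v\<close>.
\<close>
lemma inexact_prox_descent:
  fixes h :: "'a::real_normed_vector \<Rightarrow> ereal" and v g :: "'a \<Rightarrow>\<^sub>L real"
  assumes h: "proper_closed_convex h"
    and diff: "\<And>z. \<psi> differentiable (at z)"
    and sc: "\<And>u w. bregman \<psi> u w \<ge> (1/2) * (norm (u - w))\<^sup>2"
    and \<eta>: "0 < \<eta>"
    and xt: "is_arg_min (prox_obj h \<psi> v \<eta> x) (\<lambda>_. True) xt"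
    and xp: "is_arg_min (prox_obj h \<psi> g \<eta> x) (\<lambda>_. True) xp"
    and r: "h x = ereal r"
  shows "\<exists>rp. h xp = ereal rp \<and>
    rp + blinfun_apply v (xp - x) + bregman \<psi> xp x / \<eta> + (norm (x - xt))\<^sup>2 / (2 * \<eta>)
      \<le> r + \<eta> / 2 * (norm (g - v))\<^sup>2"
proof -
  obtain rt where rt: "h xt = ereal rt"
    and 1: "rt + blinfun_apply v (xt - x) + (bregman \<psi> xt x + bregman \<psi> x xt) / \<eta>
      \<le> r + bregman \<psi> x x / \<eta>"
    using prox_three_point_inequality[OF h diff \<eta> xt r] by blast
  obtain rp where rp: "h xp = ereal rp"
    and 2: "rp + blinfun_apply g (xp - xt) + (bregman \<psi> xp x + bregman \<psi> xt xp) / \<eta>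
      \<le> rt + bregman \<psi> xt x / \<eta>"
    using prox_three_point_inequality[OF h diff \<eta> xp rt] by blast
  have "- blinfun_apply (g - v) (xp - xt) \<le> norm (g - v) * norm (xt - xp)"
    using norm_blinfun[of "g - v" "xp - xt"] by (simp add: norm_minus_commute abs_le_iff)
  also have "\<dots> \<le> \<eta> / 2 * (norm (g - v))\<^sup>2 + (norm (xt - xp))\<^sup>2 / (2 * \<eta>)"
  proof -
    have "0 \<le> (\<eta> * norm (g - v) - norm (xt - xp))\<^sup>2 / (2 * \<eta>)" using \<eta> by simp
    also have "\<dots> = \<eta> / 2 * (norm (g - v))\<^sup>2 + (norm (xt - xp))\<^sup>2 / (2 * \<eta>)
        - norm (g - v) * norm (xt - xp)"
      using \<eta> by (simp add: power2_eq_square field_simps)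
    finally show ?thesis by simp
  qed
  also have "(norm (xt - xp))\<^sup>2 / (2 * \<eta>) \<le> bregman \<psi> xt xp / \<eta>"
    using sc[where u=xt and w=xp] \<eta> by (simp add: field_simps)
  finally have 3: "- blinfun_apply (g - v) (xp - xt)
      \<le> \<eta> / 2 * (norm (g - v))\<^sup>2 + bregman \<psi> xt xp / \<eta>" by simp
  have 4: "(norm (x - xt))\<^sup>2 / (2 * \<eta>) \<le> bregman \<psi> x xt / \<eta>"
    using sc[where u=x and w=xt] \<eta> by (simp add: field_simps)
  have 5: "bregman \<psi> x x = 0" by (simp add: bregman_def)
  have 6: "blinfun_apply v (xt - x) + blinfun_apply g (xp - xt)
      = blinfun_apply v (xp - x) + blinfun_apply (g - v) (xp - xt)"
    by (simp add: blinfun.diff_left blinfun.diff_right)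
  show ?thesis
    using rp 1 2 3 4 6 by (simp add: 5 add_divide_distrib)
qed

section \<open>Single trajectories\<close>

text \<open>
  The batches are the only source of randomness; this is what makes every quantity of the algorithm
  adapted to the batch filtration.
\<close>
lemma ada_bpsg_run_determined_by_batches:
  assumes "ada_bpsg_run n b m fs h \<psi> \<alpha> \<theta> \<eta>min \<eta>max \<eta>0 x0 B x \<phi> \<mu> G \<xi> \<delta> \<eta>"
    and "ada_bpsg_run n b m fs h \<psi> \<alpha> \<theta> \<eta>min \<eta>max \<eta>0 x0 B' x' \<phi>' \<mu>' G' \<xi>' \<delta>' \<eta>'"
    and "\<And>j. j < k \<Longrightarrow> B j = B' j"
  shows "x k = x' k \<and> \<phi> k = \<phi>' k \<and> \<mu> k = \<mu>' k \<and> \<xi> k = \<xi>' k \<and> \<delta> k = \<delta>' k \<and> \<eta> k = \<eta>' k"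
  using assms(3)
proof (induction k)
  interpret r: ada_bpsg_run n b m fs h \<psi> \<alpha> \<theta> \<eta>min \<eta>max \<eta>0 x0 B x \<phi> \<mu> G \<xi> \<delta> \<eta> by fact
  interpret r': ada_bpsg_run n b m fs h \<psi> \<alpha> \<theta> \<eta>min \<eta>max \<eta>0 x0 B' x' \<phi>' \<mu>' G' \<xi>' \<delta>' \<eta>' by fact
  case 0
  show ?case
    by (simp add: r.x_0 r'.x_0 r.phi_0 r'.phi_0 r.mu_0 r'.mu_0 r.xi_0 r'.xi_0
        r.delta_0 r'.delta_0 r.eta_0 r'.eta_0 fun_eq_iff)
next
  interpret r: ada_bpsg_run n b m fs h \<psi> \<alpha> \<theta> \<eta>min \<eta>max \<eta>0 x0 B x \<phi> \<mu> G \<xi> \<delta> \<eta> by fact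
  interpret r': ada_bpsg_run n b m fs h \<psi> \<alpha> \<theta> \<eta>min \<eta>max \<eta>0 x0 B' x' \<phi>' \<mu>' G' \<xi>' \<delta>' \<eta>' by fact
  case (Suc k)
  then have IH: "x k = x' k" "\<phi> k = \<phi>' k" "\<mu> k = \<mu>' k" "\<xi> k = \<xi>' k" "\<delta> k = \<delta>' k" "\<eta> k = \<eta>' k"
    and B: "B k = B' k" by auto
  have phi: "\<phi> (Suc k) = \<phi>' (Suc k)"
    by (simp add: fun_eq_iff r.phi_Suc r'.phi_Suc IH B)
  have G: "G k = G' k" by (simp only: r.G_eq r'.G_eq phi IH B)
  have x: "x (Suc k) = x' (Suc k)" by (simp only: r.x_Suc r'.x_Suc G IH)
  have mu: "\<mu> (Suc k) = \<mu>' (Suc k)" by (simp only: r.mu_Suc r'.mu_Suc phi IH B)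
  have xi: "\<xi> (Suc k) = \<xi>' (Suc k)" by (simp only: r.xi_Suc r'.xi_Suc phi IH B)
  have delta: "\<delta> (Suc k) = \<delta>' (Suc k)" by (simp only: r.delta_Suc r'.delta_Suc phi IH B)
  have "\<eta> (Suc k) = \<eta>' (Suc k)" by (simp only: r.eta_Suc r'.eta_Suc xi delta IH)
  with phi x mu xi delta show ?case by blast
qed

context ada_bpsg_run
begin

lemma step_size_bounds:
  assumes "\<eta>min \<le> \<eta>max" "\<eta>min \<le> \<eta>0" "\<eta>0 \<le> \<eta>max"
  shows "\<eta> k \<in> {\<eta>min..\<eta>max}"
proof (induction k)
  case 0
  then show ?case using assms by (simp add: eta_0)
next
  case (Suc k)
  then show ?case using assms(1) by (auto simp: eta_Suc max_def min_def)
qed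

text \<open>
  The update of \<open>\<mu>\<close> changes it by exactly the change of the average of the stored gradients, as the
  entries outside the batch do not move.
\<close>
lemma table_average:
  assumes B: "\<And>k. B k \<subseteq> {1..n}"
  shows "\<mu> k = (1 / real n) *\<^sub>R (\<Sum>i\<in>{1..n}. grad (fs i) (\<phi> k i))"
proof (induction k)
  case 0
  then show ?case by (simp add: mu_0)
next
  case (Suc k)
  have "(\<Sum>i\<in>B k. grad (fs i) (\<phi> (Suc k) i) - grad (fs i) (\<phi> k i))
      = (\<Sum>i\<in>{1..n}. grad (fs i) (\<phi> (Suc k) i) - grad (fs i) (\<phi> k i))"
    by (rule sum.mono_neutral_left) (use B in \<open>auto simp: phi_Suc\<close>)
  then show ?case
    by (simp add: mu_Suc Suc sum_subtractf scaleR_diff_right)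
qed

text \<open>
  Here \<open>v i\<close> is the error of the table entry \<open>i\<close>.  As \<open>\<mu> k\<close> is the average of the table, subtracting
  the exact gradient subtracts the average of \<open>v\<close> from the batch average of \<open>v\<close>.
\<close>
lemma estimator_error:
  fixes k
  defines "v \<equiv> \<lambda>i. grad (fs i) (x k) - grad (fs i) (\<phi> k i)"
  assumes B: "\<And>k. B k \<in> batches n b" and b: "1 \<le> b"
  shows "G k - (1 / real n) *\<^sub>R (\<Sum>i\<in>{1..n}. grad (fs i) (x k))
      = (1 / real b) *\<^sub>R (\<Sum>i\<in>B k. v i - (1 / real n) *\<^sub>R (\<Sum>i\<in>{1..n}. v i))"
proof -
  have B': "\<And>k. B k \<subseteq> {1..n}" and card: "card (B k) = b"
    using B by (auto simp: batches_def)
  have "(\<Sum>i\<in>B k. grad (fs i) (\<phi> (Suc k) i) - grad (fs i) (\<phi> k i)) = (\<Sum>i\<in>B k. v i)"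
    by (rule sum.cong) (auto simp: phi_Suc v_def)
  then have "G k = (1 / real b) *\<^sub>R (\<Sum>i\<in>B k. v i) + \<mu> k"
    using G_eq[of k] by simp
  moreover have "(1 / real b) *\<^sub>R (\<Sum>i\<in>B k. v i - (1 / real n) *\<^sub>R (\<Sum>i\<in>{1..n}. v i))
      = (1 / real b) *\<^sub>R (\<Sum>i\<in>B k. v i) - (1 / real n) *\<^sub>R (\<Sum>i\<in>{1..n}. v i)"
    using b by (simp only: sum_subtractf sum_constant_scaleR card scaleR_diff_right) simp
  moreover have "(1 / real n) *\<^sub>R (\<Sum>i\<in>{1..n}. grad (fs i) (x k)) - \<mu> k
      = (1 / real n) *\<^sub>R (\<Sum>i\<in>{1..n}. v i)"
    by (simp add: table_average[OF B'] v_def sum_subtractf scaleR_diff_right)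
  ultimately show ?thesis
    by (simp add: algebra_simps)
qed

end


section \<open>Sampling of batches\<close>

lemma finite_batches: "finite (batches n b)"
  by (rule finite_subset[of _ "Pow {1..n}"]) (auto simp: batches_def)

lemma card_batches: "card (batches n b) = n choose b"
  unfolding batches_def by (subst n_subsets) auto

lemma card_batches_avoiding:
  assumes "i \<in> {1..n}"
  shows "card {S \<in> batches n b. i \<notin> S} = (n - 1) choose b"
proof -
  have "{S \<in> batches n b. i \<notin> S} = {S. S \<subseteq> {1..n} - {i} \<and> card S = b}"
    by (auto simp: batches_def)
  then show ?thesis using assms by (simp add: n_subsets)
qed

lemma fraction_of_batches_avoiding:
  assumes i: "i \<in> {1..n}" and b: "b \<le> n"
  shows "real (card {S \<in> batches n b. i \<notin> S}) / real (card (batches n b)) = 1 - real b / real n"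
proof -
  have n: "0 < n" using i by simp
  have "real (n - b) * real (n choose b) = real n * real ((n - 1) choose b)"
    using binomial_absorb_comp[of n b] by (metis of_nat_mult)
  moreover have "0 < n choose b" using b by (rule zero_less_binomial)
  ultimately show ?thesis unfolding card_batches card_batches_avoiding[OF i]
    using n b by (simp add: field_simps of_nat_diff)
qed

locale batch_sampling = prob_space P for P :: "'w measure" +
  fixes n b :: nat and B :: "'w \<Rightarrow> nat \<Rightarrow> nat set"
  assumes uniform: "uniform_batches n b P B" and b_le_n: "b \<le> n"
begin

text \<open>
  The random quantities at time \<open>k\<close> are functions of the first \<open>k\<close> batches.  Saying so pointwise,
  rather than by measurability, allows values in types without a measurable structure and makes the property
  trivial to check for compound expressions.
\<close>
definition determined :: "nat \<Rightarrow> ('w \<Rightarrow> 'c) \<Rightarrow> bool" where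
  "determined k f \<longleftrightarrow> (\<forall>\<omega>\<in>space P. \<forall>\<omega>'\<in>space P. (\<forall>j<k. B \<omega> j = B \<omega>' j) \<longrightarrow> f \<omega> = f \<omega>')"

lemma determinedI:
  assumes "\<And>\<omega> \<omega>'. \<omega> \<in> space P \<Longrightarrow> \<omega>' \<in> space P \<Longrightarrow> (\<And>j. j < k \<Longrightarrow> B \<omega> j = B \<omega>' j) \<Longrightarrow> f \<omega> = f \<omega>'"
  shows "determined k f"
  unfolding determined_def by (intro ballI impI assms) blast+

lemma determinedD:
  assumes "determined k f" "\<omega> \<in> space P" "\<omega>' \<in> space P" "\<And>j. j < k \<Longrightarrow> B \<omega> j = B \<omega>' j"
  shows "f \<omega> = f \<omega>'"
  using assms(1)[unfolded determined_def, rule_format, OF assms(2,3)] assms(4) by blast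

lemma batch_measurable: "(\<lambda>\<omega>. B \<omega> k) \<in> measurable P (count_space (batches n b))"
  using uniform by (simp add: uniform_batches_def)

lemma batch_in_batches: "\<omega> \<in> space P \<Longrightarrow> B \<omega> k \<in> batches n b"
  using measurable_space[OF batch_measurable] by simp

lemma batch_event [measurable]: "{\<omega> \<in> space P. B \<omega> k = S} \<in> events"
proof (cases "S \<in> batches n b")
  case True
  then have "(\<lambda>\<omega>. B \<omega> k) -` {S} \<inter> space P \<in> events"
    by (intro measurable_sets[OF batch_measurable]) auto
  then show ?thesis by (simp add: vimage_def Int_def conj_commute)
next
  case False
  then have "{\<omega> \<in> space P. B \<omega> k = S} = {}" using batch_in_batches by auto
  then show ?thesis by (simp only: sets.empty_sets)
qed

lemma space_batch_sigma: "space (batch_sigma P B J) = space P"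
  by (simp add: batch_sigma_def space_measure_of_conv)

lemma sets_batch_sigma:
  "sets (batch_sigma P B J)
     = sigma_sets (space P) (\<Union>j\<in>J. {(\<lambda>\<omega>. B \<omega> j) -` A \<inter> space P | A. A \<in> sets (count_space UNIV)})"
  unfolding batch_sigma_def by (rule sets_measure_of) auto

lemma batch_sigma_event:
  assumes "j \<in> J"
  shows "{\<omega> \<in> space P. B \<omega> j = S} \<in> sets (batch_sigma P B J)"
proof -
  have "{\<omega> \<in> space P. B \<omega> j = S} = (\<lambda>\<omega>. B \<omega> j) -` {S} \<inter> space P" by auto
  then show ?thesis
    unfolding sets_batch_sigma using assms by (intro sigma_sets.Basic) auto
qed

lemma batch_sigma_mono: "I \<subseteq> J \<Longrightarrow> sets (batch_sigma P B I) \<subseteq> sets (batch_sigma P B J)"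
  unfolding sets_batch_sigma by (intro sigma_sets_mono') auto

lemma subalgebra_batch_sigma: "subalgebra P (batch_sigma P B J)"
proof -
  have "(\<lambda>\<omega>. B \<omega> j) -` A \<inter> space P \<in> events" for j A
  proof -
    have "(\<lambda>\<omega>. B \<omega> j) -` A \<inter> space P = (\<Union>S\<in>A \<inter> batches n b. {\<omega> \<in> space P. B \<omega> j = S})"
      using batch_in_batches by auto
    then show ?thesis using finite_batches by (auto intro!: sets.finite_UN)
  qed
  then show ?thesis
    unfolding subalgebra_def space_batch_sigma sets_batch_sigma
    by (auto intro!: sets.sigma_sets_subset)
qed

text \<open>
  Such a function factors through the finite set of batch histories of length \<open>k\<close>.
\<close>
lemma finite_range_determined:
  assumes "determined k f"
  shows "finite (f ` space P)"
proof -
  let ?H = "\<lambda>\<omega>. restrict (B \<omega>) {..<k}"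
  have H: "?H ` space P \<subseteq> PiE {..<k} (\<lambda>_. batches n b)"
    using batch_in_batches by auto
  have fin: "finite (?H ` space P)"
    by (rule finite_subset[OF H]) (simp add: finite_PiE finite_batches)
  have "f \<omega> = f (inv_into (space P) ?H (?H \<omega>))" if "\<omega> \<in> space P" for \<omega>
  proof -
    let ?\<omega>' = "inv_into (space P) ?H (?H \<omega>)"
    have mem: "?\<omega>' \<in> space P" using that by (intro inv_into_into) auto
    have eq: "?H ?\<omega>' = ?H \<omega>" using that by (intro f_inv_into_f) auto
    have "B \<omega> j = B ?\<omega>' j" if "j < k" for j
      using fun_cong[OF eq, of j] that by simp
    then show ?thesis by (rule determinedD[OF assms \<open>\<omega> \<in> space P\<close> mem])
  qed
  then have "f ` space P \<subseteq> (\<lambda>\<tau>. f (inv_into (space P) ?H \<tau>)) ` (?H ` space P)" by blast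
  then show ?thesis using fin by (rule finite_subset[OF _ finite_imageI])
qed

text \<open>
  The event is a finite union of cylinders, one for each batch history that leads into \<open>A\<close>.
\<close>
lemma determined_event:
  assumes f: "determined k f"
  shows "{\<omega> \<in> space P. f \<omega> \<in> A} \<in> sets (batch_sigma P B {..<k})"
proof -
  let ?F = "batch_sigma P B {..<k}"
  let ?H = "\<lambda>\<omega>. restrict (B \<omega>) {..<k}"
  let ?T = "?H ` {\<omega> \<in> space P. f \<omega> \<in> A}"
  have "?T \<subseteq> PiE {..<k} (\<lambda>_. batches n b)"
    using batch_in_batches by auto
  then have fin: "finite ?T"
    by (rule finite_subset) (simp add: finite_PiE finite_batches)
  have "{\<omega> \<in> space P. \<forall>j\<in>{..<k}. B \<omega> j = \<tau> j} \<in> sets ?F" for \<tau>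
    using batch_sigma_event[of _ "{..<k}"]
    by (subst space_batch_sigma[of "{..<k}", symmetric])
       (intro sets.sets_Collect_finite_All, auto simp: space_batch_sigma)
  then have "(\<Union>\<tau>\<in>?T. {\<omega> \<in> space P. \<forall>j\<in>{..<k}. B \<omega> j = \<tau> j}) \<in> sets ?F"
    using fin by (intro sets.finite_UN) auto
  also have "(\<Union>\<tau>\<in>?T. {\<omega> \<in> space P. \<forall>j\<in>{..<k}. B \<omega> j = \<tau> j}) = {\<omega> \<in> space P. f \<omega> \<in> A}"
  proof (intro set_eqI iffI)
    fix \<omega> assume "\<omega> \<in> (\<Union>\<tau>\<in>?T. {\<omega> \<in> space P. \<forall>j\<in>{..<k}. B \<omega> j = \<tau> j})"
    then obtain \<omega>' where \<omega>': "\<omega>' \<in> space P" "f \<omega>' \<in> A" and \<omega>: "\<omega> \<in> space P"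
      and "\<forall>j<k. B \<omega> j = B \<omega>' j"
      by auto
    then have "f \<omega> = f \<omega>'" by (intro determinedD[OF f]) auto
    then show "\<omega> \<in> {\<omega> \<in> space P. f \<omega> \<in> A}" using \<omega>' \<omega> by simp
  qed auto
  finally show ?thesis .
qed

lemma determined_measurable:
  fixes f :: "'w \<Rightarrow> real"
  assumes "determined k f"
  shows "f \<in> borel_measurable (batch_sigma P B {..<k})"
proof (rule measurableI)
  fix A :: "real set"
  have "f -` A \<inter> space (batch_sigma P B {..<k}) = {\<omega> \<in> space P. f \<omega> \<in> A}"
    by (auto simp: space_batch_sigma)
  then show "f -` A \<inter> space (batch_sigma P B {..<k}) \<in> sets (batch_sigma P B {..<k})"
    using determined_event[OF assms] by simp
qed simp

lemma determined_borel:
  fixes f :: "'w \<Rightarrow> real"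
  shows "determined k f \<Longrightarrow> f \<in> borel_measurable P"
  by (rule measurable_from_subalg[OF subalgebra_batch_sigma determined_measurable])

lemma determined_integrable:
  fixes f :: "'w \<Rightarrow> real"
  assumes "determined k f"
  shows "integrable P f"
proof -
  have "bounded (f ` space P)"
    using finite_range_determined[OF assms] by (rule finite_imp_bounded)
  then obtain C where "\<forall>\<omega>\<in>space P. norm (f \<omega>) \<le> C" by (auto simp: bounded_iff)
  then show ?thesis
    by (intro integrable_const_bound[of _ C] determined_borel[OF assms]) auto
qed

text \<open>
  Expanding \<open>g \<omega> (B \<omega> k)\<close> over the possible values \<open>S\<close> of the batch leaves products of a
  function of the past and the indicator of \<open>B \<omega> k = S\<close>, whose conditional expectation is the constant
  \<open>1 / (n choose b)\<close>.
\<close>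
lemma expectation_fresh_batch:
  fixes g :: "'w \<Rightarrow> nat set \<Rightarrow> real"
  assumes g: "\<And>S. determined k (\<lambda>\<omega>. g \<omega> S)"
  shows "expectation (\<lambda>\<omega>. g \<omega> (B \<omega> k))
      = (\<Sum>S\<in>batches n b. expectation (\<lambda>\<omega>. g \<omega> S)) / real (card (batches n b))"
proof -
  let ?F = "batch_filtration P B k"
  have F: "?F = batch_sigma P B {..<k}" by (simp add: batch_filtration_def)
  interpret finite_measure_subalgebra P ?F
    by unfold_locales (simp add: F subalgebra_batch_sigma)
  let ?I = "\<lambda>S. indicator {\<omega> \<in> space P. B \<omega> k = S} :: 'w \<Rightarrow> real"
  have int: "integrable P (\<lambda>\<omega>. g \<omega> S * ?I S \<omega>)" for S
    using determined_integrable[OF g] by (intro integrable_real_mult_indicator) auto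
  have step: "expectation (\<lambda>\<omega>. g \<omega> S * ?I S \<omega>)
      = expectation (\<lambda>\<omega>. g \<omega> S) / real (card (batches n b))" if S: "S \<in> batches n b" for S
  proof -
    have "expectation (\<lambda>\<omega>. g \<omega> S * ?I S \<omega>)
        = expectation (\<lambda>\<omega>. g \<omega> S * real_cond_exp P ?F (?I S) \<omega>)"
      using int determined_measurable[OF g] by (intro real_cond_exp_intg(2)[symmetric]) (auto simp: F)
    also have "\<dots> = expectation (\<lambda>\<omega>. g \<omega> S * (1 / real (n choose b)))"
    proof (rule integral_cong_AE)
      have "AE \<omega> in P. real_cond_exp P ?F (?I S) \<omega> = 1 / real (n choose b)"
        using uniform S unfolding uniform_batches_def by blast
      then show "AE \<omega> in P. g \<omega> S * real_cond_exp P ?F (?I S) \<omega> = g \<omega> S * (1 / real (n choose b))"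
        by (rule eventually_mono) simp
    qed (intro borel_measurable_times determined_borel[OF g] borel_measurable_cond_exp2 borel_measurable_const)+
    finally show ?thesis by (simp add: card_batches)
  qed
  have "expectation (\<lambda>\<omega>. g \<omega> (B \<omega> k)) = expectation (\<lambda>\<omega>. \<Sum>S\<in>batches n b. g \<omega> S * ?I S \<omega>)"
  proof (rule Bochner_Integration.integral_cong[OF refl])
    fix \<omega> assume \<omega>: "\<omega> \<in> space P"
    then have "(\<Sum>S\<in>batches n b. g \<omega> S * ?I S \<omega>)
        = (\<Sum>S\<in>batches n b. if B \<omega> k = S then g \<omega> S else 0)"
      by (intro sum.cong) (auto simp: indicator_def)
    also have "\<dots> = g \<omega> (B \<omega> k)"
      using batch_in_batches[OF \<omega>] by (simp add: finite_batches)
    finally show "g \<omega> (B \<omega> k) = (\<Sum>S\<in>batches n b. g \<omega> S * ?I S \<omega>)" ..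
  qed
  also have "\<dots> = (\<Sum>S\<in>batches n b. expectation (\<lambda>\<omega>. g \<omega> S * ?I S \<omega>))"
    using int by (intro Bochner_Integration.integral_sum) auto
  also have "\<dots> = (\<Sum>S\<in>batches n b. expectation (\<lambda>\<omega>. g \<omega> S)) / real (card (batches n b))"
    by (simp add: step sum_divide_distrib)
  finally show ?thesis .
qed

text \<open>
  A given index avoids the fresh batch with probability \<open>1 - b / n\<close>, independently of the past.
\<close>
lemma expectation_index_not_refreshed:
  fixes a :: "nat \<Rightarrow> 'w \<Rightarrow> real"
  assumes a: "\<And>i. i \<in> {1..n} \<Longrightarrow> determined k (a i)"
  shows "expectation (\<lambda>\<omega>. \<Sum>i\<in>{1..n}. if i \<in> B \<omega> k then 0 else a i \<omega>)
      = (1 - real b / real n) * expectation (\<lambda>\<omega>. \<Sum>i\<in>{1..n}. a i \<omega>)"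
proof -
  have int: "integrable P (a i)" if "i \<in> {1..n}" for i
    using determined_integrable[OF a[OF that]] .
  have "expectation (\<lambda>\<omega>. \<Sum>i\<in>{1..n}. if i \<in> B \<omega> k then 0 else a i \<omega>)
      = (\<Sum>S\<in>batches n b. expectation (\<lambda>\<omega>. \<Sum>i\<in>{1..n}. if i \<in> S then 0 else a i \<omega>))
        / real (card (batches n b))"
  proof (rule expectation_fresh_batch[of k "\<lambda>\<omega> S. \<Sum>i\<in>{1..n}. if i \<in> S then 0 else a i \<omega>"])
    show "determined k (\<lambda>\<omega>. \<Sum>i\<in>{1..n}. if i \<in> S then 0 else a i \<omega>)" for S
      by (intro determinedI sum.cong if_cong refl determinedD[OF a])
  qed
  also have "(\<Sum>S\<in>batches n b. expectation (\<lambda>\<omega>. \<Sum>i\<in>{1..n}. if i \<in> S then 0 else a i \<omega>))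
      = (\<Sum>S\<in>batches n b. \<Sum>i\<in>{1..n}. if i \<in> S then 0 else expectation (a i))"
  proof (intro sum.cong refl)
    fix S
    have "expectation (\<lambda>\<omega>. \<Sum>i\<in>{1..n}. if i \<in> S then 0 else a i \<omega>)
        = (\<Sum>i\<in>{1..n}. expectation (\<lambda>\<omega>. if i \<in> S then 0 else a i \<omega>))"
    proof (rule Bochner_Integration.integral_sum)
      fix i assume "i \<in> {1..n}"
      then show "integrable P (\<lambda>\<omega>. if i \<in> S then 0 else a i \<omega>)"
        using int by (cases "i \<in> S") auto
    qed
    also have "\<dots> = (\<Sum>i\<in>{1..n}. if i \<in> S then 0 else expectation (a i))"
      by (intro sum.cong) auto
    finally show "expectation (\<lambda>\<omega>. \<Sum>i\<in>{1..n}. if i \<in> S then 0 else a i \<omega>)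
        = (\<Sum>i\<in>{1..n}. if i \<in> S then 0 else expectation (a i))" .
  qed
  also have "\<dots> = (\<Sum>i\<in>{1..n}. \<Sum>S\<in>batches n b. if i \<in> S then 0 else expectation (a i))"
    by (rule sum.swap)
  also have "\<dots> = (\<Sum>i\<in>{1..n}. real (card {S \<in> batches n b. i \<notin> S}) * expectation (a i))"
  proof (intro sum.cong refl)
    fix i
    have "(\<Sum>S\<in>batches n b. if i \<in> S then 0 else expectation (a i))
        = (\<Sum>S\<in>{S \<in> batches n b. i \<notin> S}. expectation (a i))"
      by (rule sum.mono_neutral_cong_right) (auto simp: finite_batches)
    then show "(\<Sum>S\<in>batches n b. if i \<in> S then 0 else expectation (a i))
        = real (card {S \<in> batches n b. i \<notin> S}) * expectation (a i)" by simp
  qed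
  also have "\<dots> / real (card (batches n b)) = (\<Sum>i\<in>{1..n}. (1 - real b / real n) * expectation (a i))"
    unfolding sum_divide_distrib
  proof (intro sum.cong refl)
    fix i assume i: "i \<in> {1..n}"
    show "real (card {S \<in> batches n b. i \<notin> S}) * expectation (a i) / real (card (batches n b))
        = (1 - real b / real n) * expectation (a i)"
      unfolding fraction_of_batches_avoiding[OF i b_le_n, symmetric] by simp
  qed
  also have "\<dots> = (1 - real b / real n) * expectation (\<lambda>\<omega>. \<Sum>i\<in>{1..n}. a i \<omega>)"
    using int by (simp add: sum_distrib_left[symmetric] Bochner_Integration.integral_sum)
  finally show ?thesis .
qed

text \<open>
  A uniform index independent of the batches turns the expectation at a random time into the average
  over time: \<open>r k\<close> is measurable for the batches, hence independent of the event that \<open>R\<close> equals \<open>k\<close>.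
\<close>
lemma expectation_uniform_index:
  fixes r :: "nat \<Rightarrow> 'w \<Rightarrow> real"
  assumes r: "\<And>k. k < K \<Longrightarrow> determined k (r k)"
    and R: "R \<in> measurable P (count_space {..<K})"
    and R_uniform: "distr P (count_space {..<K}) R = uniform_count_measure {..<K}"
    and R_indep: "indep_set (sets (vimage_algebra (space P) R (count_space UNIV)))
      (sets (batch_sigma P B UNIV))"
  shows "integrable P (\<lambda>\<omega>. r (R \<omega>) \<omega>)"
    and "expectation (\<lambda>\<omega>. r (R \<omega>) \<omega>) = (\<Sum>k<K. expectation (r k)) / real K"
proof -
  let ?E = "\<lambda>k. {\<omega> \<in> space P. R \<omega> = k}"
  let ?I = "\<lambda>k. indicator (?E k) :: 'w \<Rightarrow> real"
  have E_vimage: "?E k = R -` {k} \<inter> space P" for k by auto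
  have E_alg: "?E k \<in> sets (vimage_algebra (space P) R (count_space UNIV))" for k
    unfolding E_vimage by (rule in_vimage_algebra) simp
  have E [measurable]: "?E k \<in> events" for k
    using indep_setD_ev1[OF R_indep] E_alg by blast
  have prob_E: "prob (?E k) = 1 / real K" if "k < K" for k
  proof -
    have "prob (?E k) = measure (distr P (count_space {..<K}) R) {k}"
      using R that by (subst measure_distr) (auto simp: E_vimage)
    also have "\<dots> = 1 / real K"
      using that by (simp add: R_uniform measure_uniform_count_measure)
    finally show ?thesis .
  qed
  have indep: "indep_var borel (?I k) borel (r k)" if k: "k < K" for k
  proof -
    let ?F = "batch_sigma P B {..<k}" and ?V = "vimage_algebra (space P) R (count_space UNIV)"
    have V: "?I k \<in> borel_measurable ?V"
      using E_alg by (intro borel_measurable_indicator)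
    have 1: "sigma_sets (space P) {?I k -` A \<inter> space P | A. A \<in> sets borel} \<subseteq> sets ?V"
    proof -
      have "{?I k -` A \<inter> space P | A. A \<in> sets borel} \<subseteq> sets ?V"
        using measurable_sets[OF V] by auto
      from sets.sigma_sets_subset[OF this] show ?thesis by simp
    qed
    have 2: "sigma_sets (space P) {r k -` A \<inter> space P | A. A \<in> sets borel}
        \<subseteq> sets (batch_sigma P B UNIV)"
    proof -
      have "{r k -` A \<inter> space P | A. A \<in> sets borel} \<subseteq> sets ?F"
        using measurable_sets[OF determined_measurable[OF r[OF k]]] by (auto simp: space_batch_sigma)
      also have "\<dots> \<subseteq> sets (batch_sigma P B UNIV)" by (rule batch_sigma_mono) simp
      finally show ?thesis
        using sets.sigma_sets_subset[of _ "batch_sigma P B UNIV"] by (simp add: space_batch_sigma)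
    qed
    show ?thesis
      unfolding indep_var_eq
    proof (intro conjI)
      show "random_variable borel (?I k)" by simp
      show "random_variable borel (r k)" using determined_borel[OF r[OF k]] .
      show "indep_set (sigma_sets (space P) {?I k -` A \<inter> space P | A. A \<in> sets borel})
          (sigma_sets (space P) {r k -` A \<inter> space P | A. A \<in> sets borel})"
      proof (rule indep_setI)
        show "sigma_sets (space P) {?I k -` A \<inter> space P | A. A \<in> sets borel} \<subseteq> events"
          by (rule subset_trans[OF 1 indep_setD_ev1[OF R_indep]])
        show "sigma_sets (space P) {r k -` A \<inter> space P | A. A \<in> sets borel} \<subseteq> events"
          by (rule subset_trans[OF 2 indep_setD_ev2[OF R_indep]])
      qed (rule indep_setD[OF R_indep subsetD[OF 1] subsetD[OF 2]])
    qed
  qed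
  have intI: "integrable P (?I k)" for k
    by (rule integrable_real_indicator) (use E in \<open>simp_all add: emeasure_eq_measure\<close>)
  have int: "integrable P (\<lambda>\<omega>. ?I k \<omega> * r k \<omega>)"
    and val: "expectation (\<lambda>\<omega>. ?I k \<omega> * r k \<omega>) = expectation (r k) / real K" if "k < K" for k
    using indep_var_integrable[OF indep[OF that] intI determined_integrable[OF r[OF that]]]
      indep_var_lebesgue_integral[OF indep[OF that] intI determined_integrable[OF r[OF that]]]
    by (simp_all add: prob_E[OF that])
  have sum: "r (R \<omega>) \<omega> = (\<Sum>k<K. ?I k \<omega> * r k \<omega>)" if "\<omega> \<in> space P" for \<omega>
  proof -
    have "R \<omega> < K" using measurable_space[OF R that] by simp
    moreover have "(\<Sum>k<K. ?I k \<omega> * r k \<omega>) = (\<Sum>k<K. if k = R \<omega> then r k \<omega> else 0)"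
      using that by (intro sum.cong) (auto simp: indicator_def)
    ultimately show ?thesis by simp
  qed
  have "integrable P (\<lambda>\<omega>. \<Sum>k<K. ?I k \<omega> * r k \<omega>)"
    using int by (intro Bochner_Integration.integrable_sum) auto
  then show "integrable P (\<lambda>\<omega>. r (R \<omega>) \<omega>)"
    by (subst Bochner_Integration.integrable_cong[OF refl sum])
  have "expectation (\<lambda>\<omega>. r (R \<omega>) \<omega>) = expectation (\<lambda>\<omega>. \<Sum>k<K. ?I k \<omega> * r k \<omega>)"
    by (rule Bochner_Integration.integral_cong[OF refl sum])
  also have "\<dots> = (\<Sum>k<K. expectation (r k)) / real K"
    unfolding sum_divide_distrib
    by (subst Bochner_Integration.integral_sum) (use int val in auto)
  finally show "expectation (\<lambda>\<omega>. r (R \<omega>) \<omega>) = (\<Sum>k<K. expectation (r k)) / real K" .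
qed

end


section \<open>Staleness of the gradient table\<close>

lemma norm_add_square_le:
  fixes u w :: "'a::real_normed_vector"
  assumes t: "0 < t"
  shows "(norm (u + w))\<^sup>2 \<le> (1 + 1 / t) * (norm u)\<^sup>2 + (1 + t) * (norm w)\<^sup>2"
proof -
  have "(norm (u + w))\<^sup>2 \<le> (norm u + norm w)\<^sup>2"
    by (intro power_mono norm_triangle_ineq) simp
  also have "\<dots> = (1 + 1 / t) * (norm u)\<^sup>2 + (1 + t) * (norm w)\<^sup>2 - (norm u - t * norm w)\<^sup>2 / t"
    using t by (simp add: power2_eq_square field_simps)
  also have "\<dots> \<le> (1 + 1 / t) * (norm u)\<^sup>2 + (1 + t) * (norm w)\<^sup>2"
    using t by simp
  finally show ?thesis .
qed

text \<open>
  In a Hilbert space the factor would be 1; for a general norm the triangle inequality and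
  Cauchy-Schwarz give 4.  The factor 8 in \<open>Gamma_b\<close> is this 4 times the 2 of the bound on the total
  staleness.
\<close>
lemma sum_deviation_squares_le:
  fixes v :: "nat \<Rightarrow> 'a::real_normed_vector"
  assumes vbar: "vbar = (1 / real n) *\<^sub>R (\<Sum>i\<in>{1..n}. v i)"
  shows "(\<Sum>i\<in>{1..n}. (norm (v i - vbar))\<^sup>2) \<le> 4 * (\<Sum>i\<in>{1..n}. (norm (v i))\<^sup>2)"
proof -
  have "(norm (\<Sum>i\<in>{1..n}. v i))\<^sup>2 \<le> (\<Sum>i\<in>{1..n}. norm (v i))\<^sup>2"
    by (intro power_mono norm_sum) simp
  also have "\<dots> \<le> (\<Sum>i\<in>{1..n}. (norm (v i))\<^sup>2) * real n"
    using sum_squared_le_sum_of_squares[of "\<lambda>i. norm (v i)" "{1..n}"] by simp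
  finally have "real n * (norm vbar)\<^sup>2 \<le> (\<Sum>i\<in>{1..n}. (norm (v i))\<^sup>2)"
    by (cases "n = 0") (auto simp: vbar power_divide power2_eq_square field_simps)
  moreover have "(\<Sum>i\<in>{1..n}. (norm (v i - vbar))\<^sup>2)
      \<le> (\<Sum>i\<in>{1..n}. 2 * (norm (v i))\<^sup>2 + 2 * (norm vbar)\<^sup>2)"
  proof (rule sum_mono)
    fix i
    show "(norm (v i - vbar))\<^sup>2 \<le> 2 * (norm (v i))\<^sup>2 + 2 * (norm vbar)\<^sup>2"
      using norm_add_square_le[of 1 "v i" "- vbar"] by simp
  qed
  ultimately show ?thesis
    by (simp add: sum.distrib sum_distrib_left[symmetric])
qed

text \<open>
  The induction carries the extra term \<open>a K\<close> on the left; it is what the next step contracts.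
\<close>
lemma sum_of_contracting_sequence_le:
  fixes a d :: "nat \<Rightarrow> real"
  assumes "a 0 = 0" and step: "\<And>k. a (Suc k) \<le> (1 - q) * a k + c * d k" and nonneg: "\<And>k. 0 \<le> a k"
  shows "q * (\<Sum>k<K. a k) \<le> c * (\<Sum>k<K. d k)"
proof -
  have "q * (\<Sum>k<K. a k) + a K \<le> c * (\<Sum>k<K. d k)"
  proof (induction K)
    case 0
    then show ?case using assms(1) by simp
  next
    case (Suc K)
    then show ?case using step[of K] by (simp add: algebra_simps)
  qed
  then show ?thesis using nonneg[of K] by linarith
qed

locale ada_bpsg_process = batch_sampling P n b B
  for P :: "'w measure" and n b :: nat and B :: "'w \<Rightarrow> nat \<Rightarrow> nat set" +
  fixes m :: nat
    and fs :: "nat \<Rightarrow> 'a::real_normed_vector \<Rightarrow> real" and h :: "'a \<Rightarrow> ereal" and \<psi> :: "'a \<Rightarrow> real"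
    and \<alpha> \<theta> \<eta>min \<eta>max \<eta>0 :: real and x0 :: 'a
    and x :: "'w \<Rightarrow> nat \<Rightarrow> 'a" and \<phi> :: "'w \<Rightarrow> nat \<Rightarrow> nat \<Rightarrow> 'a"
    and \<mu> G :: "'w \<Rightarrow> nat \<Rightarrow> ('a \<Rightarrow>\<^sub>L real)" and \<xi> \<delta> \<eta> :: "'w \<Rightarrow> nat \<Rightarrow> real"
  assumes b_pos: "1 \<le> b"
    and run: "\<And>\<omega>. \<omega> \<in> space P \<Longrightarrow>
      ada_bpsg_run n b m fs h \<psi> \<alpha> \<theta> \<eta>min \<eta>max \<eta>0 x0
        (B \<omega>) (x \<omega>) (\<phi> \<omega>) (\<mu> \<omega>) (G \<omega>) (\<xi> \<omega>) (\<delta> \<omega>) (\<eta> \<omega>)"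
begin

lemma determined_state: "determined k (\<lambda>\<omega>. s (x \<omega> k) (\<phi> \<omega> k) (\<eta> \<omega> k))"
proof (rule determinedI)
  fix \<omega> \<omega>' assume "\<omega> \<in> space P" "\<omega>' \<in> space P" "\<And>j. j < k \<Longrightarrow> B \<omega> j = B \<omega>' j"
  from ada_bpsg_run_determined_by_batches[OF run[OF this(1)] run[OF this(2)] this(3)]
  show "s (x \<omega> k) (\<phi> \<omega> k) (\<eta> \<omega> k) = s (x \<omega>' k) (\<phi> \<omega>' k) (\<eta> \<omega>' k)" by simp
qed

lemma determined_transition:
  "determined (Suc k) (\<lambda>\<omega>. s (x \<omega> k) (\<phi> \<omega> k) (B \<omega> k) (x \<omega> (Suc k)))"
proof (rule determinedI)
  fix \<omega> \<omega>' assume \<omega>: "\<omega> \<in> space P" "\<omega>' \<in> space P" and B: "\<And>j. j < Suc k \<Longrightarrow> B \<omega> j = B \<omega>' j"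
  have "x \<omega> k = x \<omega>' k \<and> \<phi> \<omega> k = \<phi> \<omega>' k"
    using ada_bpsg_run_determined_by_batches[OF run[OF \<omega>(1)] run[OF \<omega>(2)], of k] B by simp
  moreover have "x \<omega> (Suc k) = x \<omega>' (Suc k)"
    using ada_bpsg_run_determined_by_batches[OF run[OF \<omega>(1)] run[OF \<omega>(2)], of "Suc k"] B by simp
  ultimately show "s (x \<omega> k) (\<phi> \<omega> k) (B \<omega> k) (x \<omega> (Suc k))
      = s (x \<omega>' k) (\<phi> \<omega>' k) (B \<omega>' k) (x \<omega>' (Suc k))" using B[of k] by simp
qed

definition staleness :: "nat \<Rightarrow> 'w \<Rightarrow> real" where
  "staleness k \<omega> = (\<Sum>i\<in>{1..n}. (norm (x \<omega> k - \<phi> \<omega> k i))\<^sup>2)"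

definition step_sq :: "nat \<Rightarrow> 'w \<Rightarrow> real" where
  "step_sq k \<omega> = (norm (x \<omega> (Suc k) - x \<omega> k))\<^sup>2"

definition table_error :: "nat \<Rightarrow> 'w \<Rightarrow> nat \<Rightarrow> ('a \<Rightarrow>\<^sub>L real)" where
  "table_error k \<omega> i = grad (fs i) (x \<omega> k) - grad (fs i) (\<phi> \<omega> k i)"

definition estimate_error :: "nat \<Rightarrow> 'w \<Rightarrow> ('a \<Rightarrow>\<^sub>L real)" where
  "estimate_error k \<omega> = G \<omega> k - (1 / real n) *\<^sub>R (\<Sum>i\<in>{1..n}. grad (fs i) (x \<omega> k))"

lemma integrable_staleness: "integrable P (staleness k)"
  unfolding staleness_def
  by (rule determined_integrable) (rule determined_state[of k "\<lambda>y p _. \<Sum>i\<in>{1..n}. (norm (y - p i))\<^sup>2"])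

lemma integrable_step_sq: "integrable P (step_sq k)"
  unfolding step_sq_def
  by (rule determined_integrable) (rule determined_transition[of k "\<lambda>y _ _ z. (norm (z - y))\<^sup>2"])

text \<open>
  A refreshed entry is at distance \<open>\<parallel>d\<^sub>k\<parallel>\<close> from the new iterate, where \<open>d\<^sub>k\<close> is the step.  For a
  surviving entry, Young's inequality with the parameter \<open>t = (p / 2) / (1 - p)\<close> is balanced so that the
  survival probability \<open>1 - p\<close> times \<open>1 + t\<close> is \<open>1 - p / 2\<close>; the step then has the weight
  \<open>1 + 1 / t = (2 - p) / p\<close>, which is at least 1 and so covers the refreshed entries as well.
\<close>
lemma staleness_recursion:
  fixes p :: real
  defines "p \<equiv> real b / real n"
  shows "expectation (staleness (Suc k))
    \<le> (1 - p / 2) * expectation (staleness k) + real n * ((2 - p) / p) * expectation (step_sq k)"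
proof -
  have p: "0 < p" "p \<le> 1" using b_pos b_le_n by (auto simp: p_def)
  \<comment> \<open>For \<open>p = 1\<close> every entry is refreshed; then \<open>c = 0\<close> since division by zero gives zero.\<close>
  define c where "c = (1 - p / 2) / (1 - p)"
  define kept where "kept \<omega> = (\<Sum>i\<in>{1..n}. if i \<in> B \<omega> k then 0 else (norm (x \<omega> k - \<phi> \<omega> k i))\<^sup>2)" for \<omega>
  have kept_int: "integrable P kept"
    unfolding kept_def
    by (rule determined_integrable)
       (rule determined_transition[of k "\<lambda>y q S _. \<Sum>i\<in>{1..n}. if i \<in> S then 0 else (norm (y - q i))\<^sup>2"])
  have "staleness (Suc k) \<omega> \<le> c * kept \<omega> + real n * ((2 - p) / p) * step_sq k \<omega>"
    if \<omega>: "\<omega> \<in> space P" for \<omega>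
  proof -
    interpret ada_bpsg_run n b m fs h \<psi> \<alpha> \<theta> \<eta>min \<eta>max \<eta>0 x0
        "B \<omega>" "x \<omega>" "\<phi> \<omega>" "\<mu> \<omega>" "G \<omega>" "\<xi> \<omega>" "\<delta> \<omega>" "\<eta> \<omega>" by (rule run[OF \<omega>])
    have "(norm (x \<omega> (Suc k) - \<phi> \<omega> (Suc k) i))\<^sup>2
        \<le> c * (if i \<in> B \<omega> k then 0 else (norm (x \<omega> k - \<phi> \<omega> k i))\<^sup>2) + (2 - p) / p * step_sq k \<omega>"
      if i: "i \<in> {1..n}" for i
    proof (cases "i \<in> B \<omega> k")
      case True
      have "1 \<le> (2 - p) / p" using p by (simp add: field_simps)
      then have "1 * step_sq k \<omega> \<le> (2 - p) / p * step_sq k \<omega>"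
        by (intro mult_right_mono) (simp_all add: step_sq_def)
      then show ?thesis using True by (simp add: phi_Suc step_sq_def)
    next
      case False
      have "B \<omega> k \<subset> {1..n}" using batch_in_batches[OF \<omega>, of k] i False by (auto simp: batches_def)
      from psubset_card_mono[OF _ this] have "b < n"
        using batch_in_batches[OF \<omega>, of k] by (simp add: batches_def)
      then have p1: "p < 1" by (simp add: p_def)
      define t where "t = (p / 2) / (1 - p)"
      have t: "0 < t" using p p1 by (simp add: t_def)
      have ct: "1 + t = c" "1 + 1 / t = (2 - p) / p"
        using p p1 by (simp_all add: t_def c_def field_simps)
      show ?thesis
        using norm_add_square_le[OF t, of "x \<omega> (Suc k) - x \<omega> k" "x \<omega> k - \<phi> \<omega> k i"] False
        unfolding ct by (simp add: phi_Suc step_sq_def)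
    qed
    then have "staleness (Suc k) \<omega> \<le> (\<Sum>i\<in>{1..n}.
        c * (if i \<in> B \<omega> k then 0 else (norm (x \<omega> k - \<phi> \<omega> k i))\<^sup>2) + (2 - p) / p * step_sq k \<omega>)"
      unfolding staleness_def by (rule sum_mono)
    then show ?thesis
      by (simp add: sum.distrib sum_distrib_left[symmetric] kept_def)
  qed
  then have "expectation (staleness (Suc k))
      \<le> expectation (\<lambda>\<omega>. c * kept \<omega> + real n * ((2 - p) / p) * step_sq k \<omega>)"
    by (intro integral_mono integrable_staleness Bochner_Integration.integrable_add
        integrable_mult_right kept_int integrable_step_sq)
  also have "\<dots> = c * expectation kept + real n * ((2 - p) / p) * expectation (step_sq k)"
    using kept_int integrable_step_sq by simp
  also have "expectation kept = (1 - p) * expectation (staleness k)"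
    unfolding kept_def staleness_def p_def
    by (rule expectation_index_not_refreshed)
       (rule determined_state[of k "\<lambda>y q _. (norm (y - q i))\<^sup>2" for i])
  also have "c * ((1 - p) * expectation (staleness k)) \<le> (1 - p / 2) * expectation (staleness k)"
  proof -
    have "c * (1 - p) \<le> 1 - p / 2" using p by (cases "p = 1") (auto simp: c_def)
    moreover have "0 \<le> expectation (staleness k)"
      by (intro Bochner_Integration.integral_nonneg) (simp add: staleness_def sum_nonneg)
    ultimately show ?thesis
      using mult_right_mono by (fastforce simp: mult.assoc[symmetric])
  qed
  finally show ?thesis by simp
qed

text \<open>
  All entries of the initial table equal \<open>x 0\<close>, so the recursion starts at zero and leaves no
  boundary term.
\<close>
lemma total_staleness_bound:
  "(\<Sum>k<K. expectation (staleness k))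
     \<le> 2 * real n * real n * (2 * real n - real b) / (real b)\<^sup>2 * (\<Sum>k<K. expectation (step_sq k))"
proof -
  define p where "p = real b / real n"
  have n: "0 < real n" "0 < real b" using b_pos b_le_n by auto
  have "expectation (staleness 0) = expectation (\<lambda>_. 0)"
  proof (rule Bochner_Integration.integral_cong[OF refl])
    fix \<omega> assume "\<omega> \<in> space P"
    then interpret ada_bpsg_run n b m fs h \<psi> \<alpha> \<theta> \<eta>min \<eta>max \<eta>0 x0
        "B \<omega>" "x \<omega>" "\<phi> \<omega>" "\<mu> \<omega>" "G \<omega>" "\<xi> \<omega>" "\<delta> \<omega>" "\<eta> \<omega>" by (rule run)
    show "staleness 0 \<omega> = 0" by (simp add: staleness_def x_0 phi_0)
  qed
  then have "p / 2 * (\<Sum>k<K. expectation (staleness k))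
      \<le> real n * ((2 - p) / p) * (\<Sum>k<K. expectation (step_sq k))"
    using staleness_recursion unfolding p_def
    by (intro sum_of_contracting_sequence_le)
       (auto intro!: Bochner_Integration.integral_nonneg simp: staleness_def sum_nonneg)
  then have "(\<Sum>k<K. expectation (staleness k))
      \<le> (real n * ((2 - p) / p) * (\<Sum>k<K. expectation (step_sq k))) / (p / 2)"
    using n by (subst pos_le_divide_eq) (auto simp: p_def mult.commute)
  also have "\<dots> = 2 * real n * real n * (2 * real n - real b) / (real b)\<^sup>2 * (\<Sum>k<K. expectation (step_sq k))"
    using n by (simp add: p_def field_simps power2_eq_square)
  finally show ?thesis .
qed

section \<open>Variance of the gradient estimator\<close>

lemma estimate_error_eq:
  assumes "\<omega> \<in> space P"
  shows "estimate_error k \<omega> = (1 / real b) *\<^sub>R (\<Sum>i\<in>B \<omega> k. table_error k \<omega> i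
      - (1 / real n) *\<^sub>R (\<Sum>i\<in>{1..n}. table_error k \<omega> i))"
  unfolding estimate_error_def table_error_def
  by (rule ada_bpsg_run.estimator_error[OF run[OF assms] batch_in_batches[OF assms] b_pos])

lemma integrable_estimate_error: "integrable P (\<lambda>\<omega>. (norm (estimate_error k \<omega>))\<^sup>2)"
proof (subst Bochner_Integration.integrable_cong[OF refl])
  show "integrable P (\<lambda>\<omega>. (norm ((1 / real b) *\<^sub>R (\<Sum>i\<in>B \<omega> k. table_error k \<omega> i
      - (1 / real n) *\<^sub>R (\<Sum>i\<in>{1..n}. table_error k \<omega> i))))\<^sup>2)"
    unfolding table_error_def
    by (rule determined_integrable)
       (rule determined_transition[of k "\<lambda>y q S _. (norm ((1 / real b) *\<^sub>R
          (\<Sum>i\<in>S. grad (fs i) y - grad (fs i) (q i)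
            - (1 / real n) *\<^sub>R (\<Sum>i\<in>{1..n}. grad (fs i) y - grad (fs i) (q i)))))\<^sup>2"])
qed (simp add: estimate_error_eq)

text \<open>
  Conditionally on the past, the table errors are fixed vectors and only the batch is random, so the
  variance hypothesis for deterministic vectors applies with the values at a fixed \<open>\<omega>\<close>.
\<close>
lemma estimate_error_variance:
  assumes sigma_b: "0 \<le> \<sigma>b"
    and variance: "\<And>(v :: nat \<Rightarrow> ('a \<Rightarrow>\<^sub>L real)) vbar.
      vbar = (1 / real n) *\<^sub>R (\<Sum>i\<in>{1..n}. v i) \<Longrightarrow>
      expectation (\<lambda>\<omega>. (norm ((1 / real b) *\<^sub>R (\<Sum>i\<in>B \<omega> k. v i - vbar)))\<^sup>2)
        \<le> \<sigma>b / (real b * real n) * (\<Sum>i\<in>{1..n}. (norm (v i - vbar))\<^sup>2)"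
    and in_D: "AE \<omega> in P. x \<omega> k \<in> D \<and> (\<forall>i\<in>{1..n}. \<phi> \<omega> k i \<in> D)"
    and lipschitz: "\<And>u v i. u \<in> D \<Longrightarrow> v \<in> D \<Longrightarrow> i \<in> {1..n} \<Longrightarrow>
      norm (grad (fs i) u - grad (fs i) v) \<le> M * norm (u - v)"
  shows "expectation (\<lambda>\<omega>. (norm (estimate_error k \<omega>))\<^sup>2)
      \<le> 4 * \<sigma>b * M\<^sup>2 / (real b * real n) * expectation (staleness k)"
proof -
  define vbar where "vbar \<omega> = (1 / real n) *\<^sub>R (\<Sum>i\<in>{1..n}. table_error k \<omega> i)" for \<omega>
  define g where "g \<omega> S = (norm ((1 / real b) *\<^sub>R (\<Sum>i\<in>S. table_error k \<omega> i - vbar \<omega>)))\<^sup>2" for \<omega> S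
  have g_det: "determined k (\<lambda>\<omega>. g \<omega> S)" for S
    unfolding g_def vbar_def table_error_def
    by (rule determined_state[of k "\<lambda>y q _. (norm ((1 / real b) *\<^sub>R
          (\<Sum>i\<in>S. grad (fs i) y - grad (fs i) (q i)
            - (1 / real n) *\<^sub>R (\<Sum>i\<in>{1..n}. grad (fs i) y - grad (fs i) (q i)))))\<^sup>2"])
  have g_int: "integrable P (\<lambda>\<omega>. g \<omega> S)" for S
    using determined_integrable[OF g_det] .
  have "expectation (\<lambda>\<omega>. (norm (estimate_error k \<omega>))\<^sup>2) = expectation (\<lambda>\<omega>. g \<omega> (B \<omega> k))"
    by (rule Bochner_Integration.integral_cong[OF refl]) (simp only: g_def vbar_def estimate_error_eq)
  also have "\<dots> = (\<Sum>S\<in>batches n b. expectation (\<lambda>\<omega>. g \<omega> S)) / real (card (batches n b))"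
    by (rule expectation_fresh_batch[OF g_det])
  also have "\<dots> = expectation (\<lambda>\<omega>. (\<Sum>S\<in>batches n b. g \<omega> S) / real (card (batches n b)))"
    using g_int by (simp add: Bochner_Integration.integral_sum)
  also have "\<dots> \<le> expectation (\<lambda>\<omega>. 4 * \<sigma>b * M\<^sup>2 / (real b * real n) * staleness k \<omega>)"
  proof (rule integral_mono_AE)
    show "integrable P (\<lambda>\<omega>. (\<Sum>S\<in>batches n b. g \<omega> S) / real (card (batches n b)))"
      using g_int by (intro integrable_divide Bochner_Integration.integrable_sum) auto
    show "integrable P (\<lambda>\<omega>. 4 * \<sigma>b * M\<^sup>2 / (real b * real n) * staleness k \<omega>)"
      by (intro integrable_mult_right integrable_staleness)
    show "AE \<omega> in P. (\<Sum>S\<in>batches n b. g \<omega> S) / real (card (batches n b))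
        \<le> 4 * \<sigma>b * M\<^sup>2 / (real b * real n) * staleness k \<omega>"
      using in_D
    proof eventually_elim
      fix \<omega> assume D: "x \<omega> k \<in> D \<and> (\<forall>i\<in>{1..n}. \<phi> \<omega> k i \<in> D)"
      \<comment> \<open>Freezing \<open>\<omega>\<close> in the first argument turns the average over batches back into an expectation.\<close>
      have "(\<Sum>S\<in>batches n b. g \<omega> S) / real (card (batches n b)) = expectation (\<lambda>\<omega>'. g \<omega> (B \<omega>' k))"
        using expectation_fresh_batch[of k "\<lambda>_. g \<omega>"] by (simp add: determined_def prob_space)
      also have "\<dots> \<le> \<sigma>b / (real b * real n) * (\<Sum>i\<in>{1..n}. (norm (table_error k \<omega> i - vbar \<omega>))\<^sup>2)"
        unfolding g_def by (rule variance) (simp add: vbar_def)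
      also have "\<dots> \<le> \<sigma>b / (real b * real n) * (4 * (\<Sum>i\<in>{1..n}. (norm (table_error k \<omega> i))\<^sup>2))"
        using sigma_b by (intro mult_left_mono sum_deviation_squares_le) (auto simp: vbar_def)
      also have "\<dots> \<le> \<sigma>b / (real b * real n) * (4 * (M\<^sup>2 * staleness k \<omega>))"
      proof -
        have "(\<Sum>i\<in>{1..n}. (norm (table_error k \<omega> i))\<^sup>2)
            \<le> (\<Sum>i\<in>{1..n}. (M * norm (x \<omega> k - \<phi> \<omega> k i))\<^sup>2)"
          using D by (intro sum_mono power_mono) (auto simp: table_error_def intro!: lipschitz)
        then have "(\<Sum>i\<in>{1..n}. (norm (table_error k \<omega> i))\<^sup>2) \<le> M\<^sup>2 * staleness k \<omega>"
          by (simp add: power_mult_distrib staleness_def sum_distrib_left)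
        then show ?thesis using sigma_b by (intro mult_left_mono) auto
      qed
      finally show "(\<Sum>S\<in>batches n b. g \<omega> S) / real (card (batches n b))
          \<le> 4 * \<sigma>b * M\<^sup>2 / (real b * real n) * staleness k \<omega>"
        by (simp add: algebra_simps)
    qed
  qed
  also have "\<dots> = 4 * \<sigma>b * M\<^sup>2 / (real b * real n) * expectation (staleness k)"
    by simp
  finally show ?thesis .
qed

lemma total_variance_bound:
  assumes sigma_b: "0 \<le> \<sigma>b"
    and variance: "\<And>k (v :: nat \<Rightarrow> ('a \<Rightarrow>\<^sub>L real)) vbar.
      vbar = (1 / real n) *\<^sub>R (\<Sum>i\<in>{1..n}. v i) \<Longrightarrow>
      expectation (\<lambda>\<omega>. (norm ((1 / real b) *\<^sub>R (\<Sum>i\<in>B \<omega> k. v i - vbar)))\<^sup>2)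
        \<le> \<sigma>b / (real b * real n) * (\<Sum>i\<in>{1..n}. (norm (v i - vbar))\<^sup>2)"
    and in_D: "AE \<omega> in P. \<forall>k. x \<omega> k \<in> D \<and> (\<forall>i\<in>{1..n}. \<phi> \<omega> k i \<in> D)"
    and lipschitz: "\<And>u v i. u \<in> D \<Longrightarrow> v \<in> D \<Longrightarrow> i \<in> {1..n} \<Longrightarrow>
      norm (grad (fs i) u - grad (fs i) v) \<le> M * norm (u - v)"
  shows "(\<Sum>k<K. expectation (\<lambda>\<omega>. (norm (estimate_error k \<omega>))\<^sup>2))
      \<le> Gamma_b \<sigma>b M n b * (\<Sum>k<K. expectation (step_sq k))"
proof -
  let ?C = "4 * \<sigma>b * M\<^sup>2 / (real b * real n)"
  have n: "0 < real n" "0 < real b" using b_pos b_le_n by auto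
  have in_Dk: "AE \<omega> in P. x \<omega> k \<in> D \<and> (\<forall>i\<in>{1..n}. \<phi> \<omega> k i \<in> D)" for k
    using in_D by eventually_elim blast
  have "(\<Sum>k<K. expectation (\<lambda>\<omega>. (norm (estimate_error k \<omega>))\<^sup>2))
      \<le> (\<Sum>k<K. ?C * expectation (staleness k))"
    by (rule sum_mono) (rule estimate_error_variance[OF sigma_b variance in_Dk lipschitz])
  also have "\<dots> = ?C * (\<Sum>k<K. expectation (staleness k))"
    by (simp only: sum_distrib_left)
  also have "\<dots> \<le> ?C * (2 * real n * real n * (2 * real n - real b) / (real b)\<^sup>2
      * (\<Sum>k<K. expectation (step_sq k)))"
    using sigma_b by (intro mult_left_mono total_staleness_bound) simp
  also have "\<dots> = Gamma_b \<sigma>b M n b * (\<Sum>k<K. expectation (step_sq k))"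
    using n by (simp add: Gamma_b_def field_simps power2_eq_square power3_eq_cube)
  finally show ?thesis .
qed

end


section \<open>Descent along a trajectory\<close>

context ada_bpsg_run
begin

context
  fixes D :: "'a set" and Lbar \<Gamma> :: real
  assumes h: "proper_closed_convex h"
    and psi_diff: "\<And>y. \<psi> differentiable (at y)"
    and psi_strongly_convex: "\<And>u v. bregman \<psi> u v \<ge> (1/2) * (norm (u - v))\<^sup>2"
    and prox_unique: "\<And>y g e. y \<in> D \<Longrightarrow> e \<in> {\<eta>min..\<eta>max} \<Longrightarrow>
      \<exists>!u. is_arg_min (prox_obj h \<psi> g e y) (\<lambda>_. True) u"
    and f_rel_smooth: "\<And>u v. u \<in> D \<Longrightarrow> v \<in> D \<Longrightarrow>
      favg n fs u - favg n fs v - blinfun_apply (grad (favg n fs) v) (u - v) \<le> Lbar * bregman \<psi> u v"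
    and eta_bounds: "0 < \<eta>min" "\<eta>min \<le> \<eta>max" "\<eta>min \<le> \<eta>0" "\<eta>0 \<le> \<eta>max"
    and step_cond: "0 \<le> \<Gamma>" "\<Gamma> * \<eta>max + Lbar \<le> 1 / \<eta>max"
    and in_D: "\<And>k. x k \<in> D"
begin

text \<open>
  The step uses \<open>\<eta> k\<close> while the bound uses \<open>\<eta>max\<close>; all three replacements go in the right direction.
  Of the gain \<open>bregman / \<eta> k \<ge> bregman / \<eta>max\<close> the part with factor \<open>Lbar\<close> pays for the smoothness
  error, and the rest, by strong convexity, yields the multiple of the squared step that later absorbs the
  variance.
\<close>
lemma objective_decrease:
  assumes r: "h (x k) = ereal r"
  shows "\<exists>r'. h (x (Suc k)) = ereal r' \<and>
    favg n fs (x (Suc k)) + r' + \<eta>max / 2 * (norm (residual n fs h \<psi> \<eta>max (\<eta> k) (x k)))\<^sup>2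
      \<le> favg n fs (x k) + r + \<eta>max / 2 * ((norm (G k - grad (favg n fs) (x k)))\<^sup>2
          - \<Gamma> * (norm (x (Suc k) - x k))\<^sup>2)"
proof -
  let ?v = "grad (favg n fs) (x k)"
  let ?xt = "prox_step h \<psi> ?v (\<eta> k) (x k)"
  let ?d = "bregman \<psi> (x (Suc k)) (x k)"
  have \<eta>: "\<eta> k \<in> {\<eta>min..\<eta>max}"
    using eta_bounds by (intro step_size_bounds) auto
  then have pos: "0 < \<eta> k" "\<eta> k \<le> \<eta>max" "0 < \<eta>max" using eta_bounds by auto
  have argmin: "is_arg_min (prox_obj h \<psi> g (\<eta> k) (x k)) (\<lambda>_. True) (prox_step h \<psi> g (\<eta> k) (x k))" for g
    unfolding prox_step_def arg_min_def
    by (rule someI_ex) (use prox_unique[OF in_D \<eta>] in blast)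
  obtain r' where r': "h (x (Suc k)) = ereal r'"
    and step: "r' + blinfun_apply ?v (x (Suc k) - x k) + ?d / \<eta> k + (norm (x k - ?xt))\<^sup>2 / (2 * \<eta> k)
      \<le> r + \<eta> k / 2 * (norm (G k - ?v))\<^sup>2"
    using inexact_prox_descent[OF h psi_diff psi_strongly_convex pos(1)
        argmin[of ?v] argmin[of "G k", folded x_Suc] r] by blast
  have smooth: "favg n fs (x (Suc k)) \<le> favg n fs (x k) + blinfun_apply ?v (x (Suc k) - x k) + Lbar * ?d"
    using f_rel_smooth[OF in_D in_D, of "Suc k" k] by simp
  have sc: "(norm (x (Suc k) - x k))\<^sup>2 / 2 \<le> ?d"
    using psi_strongly_convex[where u="x (Suc k)" and v="x k"] by simp
  moreover have "0 \<le> (norm (x (Suc k) - x k))\<^sup>2 / 2" by simp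
  ultimately have d: "0 \<le> ?d" by linarith
  have "\<Gamma> * \<eta>max * ((norm (x (Suc k) - x k))\<^sup>2 / 2) + Lbar * ?d \<le> \<Gamma> * \<eta>max * ?d + Lbar * ?d"
    using sc step_cond(1) pos by (intro add_right_mono mult_left_mono) auto
  also have "\<dots> = (\<Gamma> * \<eta>max + Lbar) * ?d" by (simp add: algebra_simps)
  also have "\<dots> \<le> 1 / \<eta>max * ?d" using step_cond(2) d by (rule mult_right_mono)
  also have "\<dots> \<le> ?d / \<eta> k" using d pos by (simp add: frac_le)
  finally have gain: "\<eta>max / 2 * (\<Gamma> * (norm (x (Suc k) - x k))\<^sup>2) + Lbar * ?d \<le> ?d / \<eta> k"
    by (simp add: algebra_simps)
  have "\<eta>max / 2 * (norm (residual n fs h \<psi> \<eta>max (\<eta> k) (x k)))\<^sup>2 = (norm (x k - ?xt))\<^sup>2 / (2 * \<eta>max)"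
    using pos by (simp add: residual_def power_divide power2_eq_square)
  also have "\<dots> \<le> (norm (x k - ?xt))\<^sup>2 / (2 * \<eta> k)"
    using pos by (intro divide_left_mono) auto
  finally have res: "\<eta>max / 2 * (norm (residual n fs h \<psi> \<eta>max (\<eta> k) (x k)))\<^sup>2
      \<le> (norm (x k - ?xt))\<^sup>2 / (2 * \<eta> k)" .
  have err: "\<eta> k / 2 * (norm (G k - ?v))\<^sup>2 \<le> \<eta>max / 2 * (norm (G k - ?v))\<^sup>2"
    using pos by (intro mult_right_mono) auto
  show ?thesis
    using r' step smooth gain res err by (auto simp: right_diff_distrib)
qed

lemma sum_of_residuals_le:
  assumes F_inf: "\<And>u. ereal Finf \<le> objective n fs h u" and r0: "h x0 = ereal r0"
  shows "\<eta>max / 2 * (\<Sum>k<K. (norm (residual n fs h \<psi> \<eta>max (\<eta> k) (x k)))\<^sup>2)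
      \<le> favg n fs x0 + r0 - Finf + \<eta>max / 2 * (\<Sum>k<K. (norm (G k - grad (favg n fs) (x k)))\<^sup>2
          - \<Gamma> * (norm (x (Suc k) - x k))\<^sup>2)"
proof -
  \<comment> \<open>Finiteness of \<open>h\<close> at the iterates has to be carried along for the sum to telescope in the reals.\<close>
  have "\<exists>r. h (x K) = ereal r \<and>
      favg n fs (x K) + r + \<eta>max / 2 * (\<Sum>k<K. (norm (residual n fs h \<psi> \<eta>max (\<eta> k) (x k)))\<^sup>2)
      \<le> favg n fs x0 + r0 + \<eta>max / 2 * (\<Sum>k<K. (norm (G k - grad (favg n fs) (x k)))\<^sup>2
          - \<Gamma> * (norm (x (Suc k) - x k))\<^sup>2)"
  proof (induction K)
    case 0
    then show ?case using r0 by (simp add: x_0)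
  next
    case (Suc K)
    then obtain r where r: "h (x K) = ereal r" and IH:
      "favg n fs (x K) + r + \<eta>max / 2 * (\<Sum>k<K. (norm (residual n fs h \<psi> \<eta>max (\<eta> k) (x k)))\<^sup>2)
      \<le> favg n fs x0 + r0 + \<eta>max / 2 * (\<Sum>k<K. (norm (G k - grad (favg n fs) (x k)))\<^sup>2
          - \<Gamma> * (norm (x (Suc k) - x k))\<^sup>2)" by blast
    from objective_decrease[OF r] IH show ?case
      unfolding sum.lessThan_Suc distrib_left by fastforce
  qed
  then obtain r where "h (x K) = ereal r" and
    "favg n fs (x K) + r + \<eta>max / 2 * (\<Sum>k<K. (norm (residual n fs h \<psi> \<eta>max (\<eta> k) (x k)))\<^sup>2)
      \<le> favg n fs x0 + r0 + \<eta>max / 2 * (\<Sum>k<K. (norm (G k - grad (favg n fs) (x k)))\<^sup>2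
          - \<Gamma> * (norm (x (Suc k) - x k))\<^sup>2)" by blast
  moreover from this(1) have "Finf \<le> favg n fs (x K) + r"
    using F_inf[of "x K"] by (simp add: objective_def)
  ultimately show ?thesis by linarith
qed

end

end

section \<open>Expected squared residual\<close>

theorem theorem3p11:
  fixes n b m K :: nat
    and fs :: "nat \<Rightarrow> 'a::real_normed_vector \<Rightarrow> real"
    and h :: "'a \<Rightarrow> ereal" and \<psi> :: "'a \<Rightarrow> real"
    and X D :: "'a set" and x0 :: 'a
    and \<alpha> \<theta> \<eta>min \<eta>max \<eta>0 \<sigma>b Lbar Lund M Finf :: real
    and P :: "'w measure"
    and B :: "'w \<Rightarrow> nat \<Rightarrow> nat set"
    and x :: "'w \<Rightarrow> nat \<Rightarrow> 'a" and \<phi> :: "'w \<Rightarrow> nat \<Rightarrow> nat \<Rightarrow> 'a"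
    and \<mu> G :: "'w \<Rightarrow> nat \<Rightarrow> ('a \<Rightarrow>\<^sub>L real)" and \<xi> \<delta> \<eta> :: "'w \<Rightarrow> nat \<Rightarrow> real"
    and R :: "'w \<Rightarrow> nat"
  assumes finite_dim: "\<exists>S::'a set. finite S \<and> span S = UNIV"
    and n: "1 \<le> n"
    and X: "X \<noteq> {}" "convex X" "open X"
    and f_diff: "\<And>i y. i \<in> {1..n} \<Longrightarrow> y \<in> X \<Longrightarrow> fs i differentiable (at y)"
    and f_lsc: "lower_semicontinuous_on X (favg n fs)"
    and f_C1: "cont_differentiable_on (favg n fs) X"
    and b: "1 \<le> b" "b \<le> n"
    and eta_bounds: "0 < \<eta>min" "\<eta>min \<le> \<eta>max"
    and eta0: "\<eta>min \<le> \<eta>0" "\<eta>0 \<le> \<eta>max"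
    and m: "1 \<le> m"
    and \<alpha>: "0 < \<alpha>"
    and \<theta>: "0 < \<theta>"
    and P: "prob_space P"
    and run: "\<And>\<omega>. \<omega> \<in> space P \<Longrightarrow>
      ada_bpsg_run n b m fs h \<psi> \<alpha> \<theta> \<eta>min \<eta>max \<eta>0 x0
        (B \<omega>) (x \<omega>) (\<phi> \<omega>) (\<mu> \<omega>) (G \<omega>) (\<xi> \<omega>) (\<delta> \<omega>) (\<eta> \<omega>)"
    and psi_C1: "cont_differentiable_on \<psi> UNIV"
    and psi_strongly_convex: "\<And>u v. bregman \<psi> u v \<ge> (1/2) * (norm (u - v))\<^sup>2"
    and h: "proper_closed_convex h"
    and prox_unique: "\<And>y g e. y \<in> D \<Longrightarrow> e \<in> {\<eta>min..\<eta>max} \<Longrightarrow>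
      \<exists>!u. is_arg_min (prox_obj h \<psi> g e y) (\<lambda>_. True) u"
    and D: "bounded D" "convex D" "D \<subseteq> X"
    and in_D: "AE \<omega> in P. \<forall>k. x \<omega> k \<in> D \<and> (\<forall>i\<in>{1..n}. \<phi> \<omega> k i \<in> D)"
    and batches: "uniform_batches n b P B"
    and sigma_b: "1 \<le> \<sigma>b"
    and variance: "\<And>k (v :: nat \<Rightarrow> ('a \<Rightarrow>\<^sub>L real)) vbar.
      vbar = (1 / real n) *\<^sub>R (\<Sum>i\<in>{1..n}. v i) \<Longrightarrow>
      prob_space.expectation P
        (\<lambda>\<omega>. (norm ((1 / real b) *\<^sub>R (\<Sum>i\<in>B \<omega> k. v i - vbar)))\<^sup>2)
      \<le> \<sigma>b / (real b * real n) * (\<Sum>i\<in>{1..n}. (norm (v i - vbar))\<^sup>2)"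
    and L: "0 < Lbar" "0 \<le> Lund"
    and f_rel_smooth: "\<And>u v. u \<in> D \<Longrightarrow> v \<in> D \<Longrightarrow>
      - Lund * bregman \<psi> u v
        \<le> favg n fs u - favg n fs v - blinfun_apply (grad (favg n fs) v) (u - v) \<and>
      favg n fs u - favg n fs v - blinfun_apply (grad (favg n fs) v) (u - v)
        \<le> Lbar * bregman \<psi> u v"
    and M: "0 \<le> M"
    and f_lipschitz: "\<And>u v i. u \<in> D \<Longrightarrow> v \<in> D \<Longrightarrow> i \<in> {1..n} \<Longrightarrow>
      norm (grad (fs i) u - grad (fs i) v) \<le> M * norm (u - v)"
    and F_inf: "\<And>u. ereal Finf \<le> objective n fs h u"
    and step_cond: "Gamma_b \<sigma>b M n b * \<eta>max + Lbar \<le> 1 / \<eta>max"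
    and K: "1 \<le> K"
    and R_measurable: "R \<in> measurable P (count_space {..<K})"
    and R_uniform: "distr P (count_space {..<K}) R = uniform_count_measure {..<K}"
    and R_indep: "prob_space.indep_set P
      (sets (vimage_algebra (space P) R (count_space UNIV))) (sets (batch_sigma P B UNIV))"
  shows "integrable P (\<lambda>\<omega>. (norm (residual n fs h \<psi> \<eta>max (\<eta> \<omega> (R \<omega>)) (x \<omega> (R \<omega>))))\<^sup>2) \<and>
    ereal (prob_space.expectation P
        (\<lambda>\<omega>. (norm (residual n fs h \<psi> \<eta>max (\<eta> \<omega> (R \<omega>)) (x \<omega> (R \<omega>))))\<^sup>2))
      \<le> ereal 2 * (objective n fs h x0 - ereal Finf) / ereal (real K * \<eta>max)"
proof -
  interpret prob_space P by (rule P)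
  interpret ada_bpsg_process P n b B m fs h \<psi> \<alpha> \<theta> \<eta>min \<eta>max \<eta>0 x0 x \<phi> \<mu> G \<xi> \<delta> \<eta>
    by (intro ada_bpsg_process.intro ada_bpsg_process_axioms.intro batch_sampling.intro
        batch_sampling_axioms.intro P batches b run)
  define res where "res k \<omega> = (norm (residual n fs h \<psi> \<eta>max (\<eta> \<omega> k) (x \<omega> k)))\<^sup>2" for k \<omega>
  define \<Gamma> where "\<Gamma> = Gamma_b \<sigma>b M n b"
  have \<Gamma>: "0 \<le> \<Gamma>" using sigma_b b by (simp add: \<Gamma>_def Gamma_b_def)
  have \<eta>max: "0 < \<eta>max" using eta_bounds by simp
  have res_det: "determined k (res k)" for k
    unfolding res_def by (rule determined_state[of k "\<lambda>y _ e. (norm (residual n fs h \<psi> \<eta>max e y))\<^sup>2"])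
  have res_int: "integrable P (res k)" for k
    using determined_integrable[OF res_det] .
  have int: "integrable P (\<lambda>\<omega>. res (R \<omega>) \<omega>)"
    and mean: "expectation (\<lambda>\<omega>. res (R \<omega>) \<omega>) = (\<Sum>k<K. expectation (res k)) / real K"
    by (rule expectation_uniform_index[OF res_det R_measurable R_uniform R_indep])+
  have psi_diff: "\<psi> differentiable (at y)" for y
    using psi_C1 by (simp add: cont_differentiable_on_def)
  have bound: "expectation (\<lambda>\<omega>. res (R \<omega>) \<omega>) \<le> 2 * (favg n fs x0 + r0 - Finf) / (real K * \<eta>max)"
    if r0: "h x0 = ereal r0" for r0
  proof -
    have pathwise: "AE \<omega> in P. \<eta>max / 2 * (\<Sum>k<K. res k \<omega>) \<le> favg n fs x0 + r0 - Finf
        + \<eta>max / 2 * (\<Sum>k<K. (norm (estimate_error k \<omega>))\<^sup>2 - \<Gamma> * step_sq k \<omega>)"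
      using in_D AE_space
    proof eventually_elim
      fix \<omega> assume D': "\<forall>k. x \<omega> k \<in> D \<and> (\<forall>i\<in>{1..n}. \<phi> \<omega> k i \<in> D)" and \<omega>: "\<omega> \<in> space P"
      interpret ada_bpsg_run n b m fs h \<psi> \<alpha> \<theta> \<eta>min \<eta>max \<eta>0 x0
        "B \<omega>" "x \<omega>" "\<phi> \<omega>" "\<mu> \<omega>" "G \<omega>" "\<xi> \<omega>" "\<delta> \<omega>" "\<eta> \<omega>" by (rule run[OF \<omega>])
      have err: "estimate_error k \<omega> = G \<omega> k - grad (favg n fs) (x \<omega> k)" for k
      proof -
        have "x \<omega> k \<in> X" using D' D(3) by blast
        then show ?thesis unfolding estimate_error_def by (subst grad_favg[OF f_diff]) auto
      qed
      show "\<eta>max / 2 * (\<Sum>k<K. res k \<omega>) \<le> favg n fs x0 + r0 - Finf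
          + \<eta>max / 2 * (\<Sum>k<K. (norm (estimate_error k \<omega>))\<^sup>2 - \<Gamma> * step_sq k \<omega>)"
        unfolding res_def step_sq_def err
      proof (rule sum_of_residuals_le[where D = D and Lbar = Lbar, OF h psi_diff psi_strongly_convex
            prox_unique _ eta_bounds eta0 \<Gamma> step_cond[folded \<Gamma>_def] _ F_inf r0])
        show "favg n fs u - favg n fs v - blinfun_apply (grad (favg n fs) v) (u - v)
            \<le> Lbar * bregman \<psi> u v" if "u \<in> D" "v \<in> D" for u v
          using f_rel_smooth[OF that] by simp
        show "x \<omega> k \<in> D" for k using D' by simp
      qed
    qed
    have "\<eta>max / 2 * (\<Sum>k<K. expectation (res k)) = expectation (\<lambda>\<omega>. \<eta>max / 2 * (\<Sum>k<K. res k \<omega>))"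
      using res_int by (simp add: Bochner_Integration.integral_sum)
    also have "\<dots> \<le> expectation (\<lambda>\<omega>. favg n fs x0 + r0 - Finf
        + \<eta>max / 2 * (\<Sum>k<K. (norm (estimate_error k \<omega>))\<^sup>2 - \<Gamma> * step_sq k \<omega>))"
      using pathwise
      by (intro integral_mono_AE integrable_mult_right Bochner_Integration.integrable_sum
          Bochner_Integration.integrable_add Bochner_Integration.integrable_diff res_int
          integrable_estimate_error integrable_step_sq integrable_const)
    also have "\<dots> = favg n fs x0 + r0 - Finf
        + \<eta>max / 2 * ((\<Sum>k<K. expectation (\<lambda>\<omega>. (norm (estimate_error k \<omega>))\<^sup>2))
          - \<Gamma> * (\<Sum>k<K. expectation (step_sq k)))"
      using integrable_estimate_error integrable_step_sq
      by (simp add: Bochner_Integration.integral_sum prob_space sum_subtractf sum_distrib_left)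
    also have "\<dots> \<le> favg n fs x0 + r0 - Finf"
    proof -
      have "(\<Sum>k<K. expectation (\<lambda>\<omega>. (norm (estimate_error k \<omega>))\<^sup>2))
          \<le> \<Gamma> * (\<Sum>k<K. expectation (step_sq k))"
        unfolding \<Gamma>_def
        by (rule total_variance_bound[OF _ variance in_D f_lipschitz]) (use sigma_b in auto)
      then show ?thesis using \<eta>max by (simp add: mult_le_0_iff)
    qed
    finally have "(\<Sum>k<K. expectation (res k)) \<le> 2 * (favg n fs x0 + r0 - Finf) / \<eta>max"
      using \<eta>max by (simp add: field_simps)
    then have "(\<Sum>k<K. expectation (res k)) / real K
        \<le> 2 * (favg n fs x0 + r0 - Finf) / \<eta>max / real K"
      by (rule divide_right_mono) simp
    then show ?thesis by (simp add: mean mult.commute)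
  qed
  have "ereal (expectation (\<lambda>\<omega>. res (R \<omega>) \<omega>))
      \<le> ereal 2 * (objective n fs h x0 - ereal Finf) / ereal (real K * \<eta>max)"
  \<comment> \<open>If \<open>h x0\<close> is infinite, so is the right-hand side.\<close>
  proof (cases "h x0")
    case (real r0)
    then show ?thesis using bound[OF real] \<eta>max K by (simp add: objective_def)
  next
    case PInf
    then show ?thesis using \<eta>max K by (simp add: objective_def)
  next
    case MInf
    then show ?thesis using h by (simp add: proper_closed_convex_def)
  qed
  then show ?thesis using int by (simp add: res_def)
qed

end
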